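(* Let $\Omega_{\varrho,\phi}=\{(\varrho(C),\phi(C)): C\text{ a bivariate copula}\}$. Define $\underline{\varrho}(x)=\tfrac{2\sqrt3}{9}(1+2x)^{3/2}-1$ for $x\in[-\tfrac12,1]$. Define $\overline{\varrho}(1)=1$ and, for $x\in[1-\tfrac3{2N},1-\tfrac3{2N+2})$ with $N\in\{1,2,\dots\}$, $$\overline{\varrho}(x)=1-6\ell(2m-\ell)-\frac{4\Delta^{3/2}}{\sqrt{N(N+1)}},$$ where $m=\tfrac{1-x}3$, $\ell\in\{\tfrac1{2N},\tfrac1{2N+2}\}$ is an endpoint nearest to $m$ (either one in case of a tie; the value is the same), and $\Delta=|m-\ell|$. Then $$\Omega_{\varrho,\phi}=\bigl\{(\varrho,x): x\in[-\tfrac12,1],\ \underline{\varrho}(x)\le\varrho\le\overline{\varrho}(x)\bigr\}.$$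
   Context: A bivariate copula is a bivariate distribution function $C$ on $[0,1]^2$ with uniform margins, $C(u,1)=u$, $C(1,v)=v$. Spearman's rho and Spearman's footrule are $$\varrho(C)=12\int_{[0,1]^2}C(u,v)\,d\lambda_2(u,v)-3,\qquad \phi(C)=6\int_0^1C(t,t)\,dt-2,$$ with $\lambda_2$ Lebesgue measure on $[0,1]^2$. *)

theory Defs
  imports "HOL-Probability.Probability"
begin

definition bivariate_cdf :: "(real \<times> real) measure \<Rightarrow> real \<Rightarrow> real \<Rightarrow> real" where
  "bivariate_cdf M u v = measure M ({..u} \<times> {..v})"

(* The values of C outside the unit square are irrelevant. The margin conditions force M to be
   concentrated on the unit square. *)
definition copula :: "(real \<Rightarrow> real \<Rightarrow> real) \<Rightarrow> bool" where
  "copula C \<longleftrightarrow>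
     (\<exists>M. prob_space M \<and> sets M = sets borel \<and>
        (\<forall>u\<in>{0..1}. \<forall>v\<in>{0..1}. C u v = bivariate_cdf M u v)) \<and>
     (\<forall>u\<in>{0..1}. C u 1 = u) \<and> (\<forall>v\<in>{0..1}. C 1 v = v)"

definition spearman_rho :: "(real \<Rightarrow> real \<Rightarrow> real) \<Rightarrow> real" where
  "spearman_rho C = 12 * (LINT p:{0..1} \<times> {0..1}|lborel. C (fst p) (snd p)) - 3"

definition spearman_footrule :: "(real \<Rightarrow> real \<Rightarrow> real) \<Rightarrow> real" where
  "spearman_footrule C = 6 * (LINT t:{0..1}|lborel. C t t) - 2"

definition rho_lower :: "real \<Rightarrow> real" where
  "rho_lower x = 2 * sqrt 3 / 9 * (1 + 2 * x) powr (3/2) - 1"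

definition in_segment :: "real \<Rightarrow> nat \<Rightarrow> bool" where
  "in_segment x N \<longleftrightarrow> 1 \<le> N \<and> x \<in> {1 - 3 / (2 * real N) ..< 1 - 3 / (2 * real N + 2)}"

definition segment_ends :: "nat \<Rightarrow> real set" where
  "segment_ends N = {1 / (2 * real N), 1 / (2 * real N + 2)}"

definition rho_upper_at :: "nat \<Rightarrow> real \<Rightarrow> real \<Rightarrow> real" where
  "rho_upper_at N m l =
     1 - 6 * l * (2 * m - l) - 4 * \<bar>m - l\<bar> powr (3/2) / sqrt (real N * (real N + 1))"

(* On [-1/2, 1) the index N exists and is unique (segment_ex1). In case of a tie, arg_min_on picks
   an unspecified nearest endpoint; the value does not depend on it (rho_upper_eq). *)
definition rho_upper :: "real \<Rightarrow> real" where
  "rho_upper x =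
     (if x = 1 then 1
      else let N = (THE N. in_segment x N);
               m = (1 - x) / 3;
               l = arg_min_on (\<lambda>l. \<bar>m - l\<bar>) (segment_ends N)
           in rho_upper_at N m l)"

lemma in_segment_iff:
  assumes "x < 1"
  shows "in_segment x N \<longleftrightarrow> 1 \<le> N \<and> \<lfloor>3 / (2 * (1 - x))\<rfloor> = int N"
proof (cases "1 \<le> N")
  case True
  then have N: "real N > 0" by simp
  have "1 - 3 / (2 * real N) \<le> x \<longleftrightarrow> real N \<le> 3 / (2 * (1 - x))"
    using assms N by (simp add: field_simps)
  moreover have "x < 1 - 3 / (2 * real N + 2) \<longleftrightarrow> 3 / (2 * (1 - x)) < real N + 1"
    using assms N by (simp add: field_simps)
  ultimately show ?thesis
    using True by (auto simp: in_segment_def floor_eq_iff)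
qed (simp add: in_segment_def)

lemma segment_ex1:
  assumes "-1/2 \<le> x" "x < 1"
  shows "\<exists>!N. in_segment x N"
proof -
  define k where "k = \<lfloor>3 / (2 * (1 - x))\<rfloor>"
  have "1 \<le> 3 / (2 * (1 - x))" using assms by (simp add: field_simps)
  then have "1 \<le> k" unfolding k_def by simp
  moreover have "in_segment x N \<longleftrightarrow> 1 \<le> N \<and> k = int N" for N
    unfolding k_def using assms(2) by (rule in_segment_iff)
  ultimately show ?thesis
    by (intro ex1I[of _ "nat k"]) auto
qed

lemma rho_upper_at_tie:
  assumes "l \<in> segment_ends N" "l' \<in> segment_ends N" "\<bar>m - l\<bar> = \<bar>m - l'\<bar>"
  shows "rho_upper_at N m l = rho_upper_at N m l'"
proof -
  from assms(3) consider "l = l'" | "l + l' = 2 * m" by linarith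
  then show ?thesis
  proof cases
    case 2
    then have "2 * m - l = l'" "2 * m - l' = l" by simp_all
    then show ?thesis using assms(3) by (simp add: rho_upper_at_def)
  qed simp
qed

lemma rho_upper_eq:
  assumes x: "-1/2 \<le> x" "x < 1" and N: "in_segment x N"
    and m: "m = (1 - x) / 3"
    and l: "is_arg_min (\<lambda>l. \<bar>m - l\<bar>) (\<lambda>l. l \<in> segment_ends N) l"
  shows "rho_upper x = rho_upper_at N m l"
proof -
  have the: "(THE N. in_segment x N) = N"
    using segment_ex1[OF x] N by (rule the1_equality)
  let ?l = "arg_min_on (\<lambda>l. \<bar>m - l\<bar>) (segment_ends N)"
  have fin: "finite (segment_ends N)" "segment_ends N \<noteq> {}" by (simp_all add: segment_ends_def)
  have "?l \<in> segment_ends N" using fin by (rule arg_min_if_finite)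
  moreover have "\<bar>m - ?l\<bar> = \<bar>m - l\<bar>"
    using arg_min_least[OF fin, of l "\<lambda>l. \<bar>m - l\<bar>"] l calculation
    by (auto simp: is_arg_min_linorder intro!: antisym)
  ultimately have "rho_upper_at N m ?l = rho_upper_at N m l"
    using l by (intro rho_upper_at_tie) (auto simp: is_arg_min_linorder)
  then show ?thesis
    using x by (simp add: rho_upper_def Let_def the m)
qed

end

theory Submission
  imports Defs
begin

text \<open>Let \<open>U\<close> and \<open>V\<close> be uniform on \<open>[0,1]\<close> with joint distribution function \<open>C\<close>, and call \<open>D = \<bar>U - V\<bar>\<close>
their gap. By Fubini, \<open>\<integral>C(t,t) dt = 1 - E max(U,V)\<close> and \<open>\<integral>\<integral>C = E (1 - U)(1 - V)\<close>; as the first two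
moments of \<open>U\<close> and \<open>V\<close> are known, Spearman's footrule is \<open>1 - 3 E D\<close> and Spearman's rho is
\<open>1 - 6 E D\<^sup>2\<close> (\<open>range_eq_gap_moments\<close>). The region is therefore an affine image of the set of pairs
\<open>(E D, E D\<^sup>2)\<close>, over all couplings of the uniform distribution with itself. Mixtures of couplings are
couplings, so that set is convex (\<open>coupling_convex\<close>), and it remains to find, for every
\<open>m \<in> [0,1/2]\<close>, couplings with \<open>E D = m\<close> that make \<open>E D\<^sup>2\<close> largest and smallest.

Both extrema are optimal transport problems with a Lagrange multiplier \<open>2c\<close> for the constraint:
optimize \<open>E (D\<^sup>2 - 2cD)\<close>. Optimality is certified by a dual potential \<open>f\<close>: if \<open>f(u) + f(v)\<close> bounds the
cost everywhere and equals it on the support of one coupling, then that coupling is optimal, because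
\<open>E (f(U) + f(V))\<close> has the same value for all couplings (\<open>gap_optimal\<close>).

For the maximum, mass should sit at extreme gaps: reflect, \<open>V = 1 - U\<close>, outside an interval
\<open>[1/2 - a, 1/2 + a]\<close>, and take \<open>V = U\<close> inside (\<open>max_sq_gap\<close>).

For the minimum, \<open>E D\<^sup>2 \<ge> m\<^sup>2\<close> with equality iff \<open>D = m\<close> almost surely, which for \<open>m > 0\<close> is possible exactly if \<open>[0,1]\<close>
splits into an even number of blocks of length \<open>m\<close>, that is, \<open>m = 1/(2N)\<close>, neighbouring blocks being
exchanged in pairs. For other \<open>m\<close>, bound the cost \<open>(D - c)\<^sup>2\<close> from below by the squared distance
of \<open>U + c\<close> and \<open>V\<close> modulo \<open>2c\<close>: the law of \<open>U\<close> modulo \<open>2c\<close>, which has density \<open>N + 1\<close> on an arc and \<open>N\<close> elsewhere, has to be carried to its own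
translate by \<open>c\<close>. The monotone rearrangement on the circle is piecewise linear. It spreads \<open>N + 1\<close>
intervals of half-width \<open>N\<delta>\<close>, the peak caps, over \<open>N\<close> intervals of half-width \<open>(N + 1)\<delta>\<close>, the trough
caps, moving points by \<open>c\<close> up to an error of at most \<open>\<delta>\<close>; the spacers between the caps are translated by the
constant \<open>l = c + \<delta>\<close> or \<open>l = c - \<delta>\<close>. Here \<open>l\<close> is the endpoint \<open>1/(2N)\<close> or \<open>1/(2N + 2)\<close>, and the caps fit
into one period iff \<open>4N(N + 1)\<delta> \<le> 1\<close>, which says that \<open>l\<close> is the endpoint nearest to \<open>m\<close>. Such a coupling has
\<open>E D = l \<mp> \<Delta>\<close> with \<open>\<Delta> = 4N(N + 1)\<delta>\<^sup>2\<close>, and \<open>E D\<^sup>2\<close> is \<open>l(2m - l) + 4/3 \<Delta>\<delta>\<close>: this is where the exponent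
\<open>3/2\<close> in the upper boundary comes from. The potential is an even \<open>2c\<close>-periodic function whose slope is
\<open>-2\<close> times the displacement of the rearrangement.\<close>

section \<open>Couplings of the uniform distribution\<close>

definition unif :: "real measure" where
  "unif = uniform_measure lborel {0..1}"

lemma prob_space_unif: "prob_space unif"
  unfolding unif_def by (rule prob_space_uniform_measure) auto

lemma sets_unif [simp, measurable_cong]: "sets unif = sets borel"
  by (simp add: unif_def)

lemma space_unif [simp]: "space unif = UNIV"
  by (simp add: unif_def)

lemma AE_unif: "AE t in unif. t \<in> {0..1}"
  unfolding unif_def by (rule AE_uniform_measureI) auto

lemma integral_unif:
  fixes f :: "real \<Rightarrow> real"
  assumes [measurable]: "f \<in> borel_measurable borel"
  shows "(\<integral>t. f t \<partial>unif) = (LINT t:{0..1}|lborel. f t)"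
proof -
  have "unif = density lborel (\<lambda>x. ennreal (indicator {0..1} x))"
    unfolding unif_def uniform_measure_def
    by (intro density_cong) (auto split: split_indicator)
  then have "(\<integral>t. f t \<partial>unif) = (\<integral>t. f t \<partial>density lborel (\<lambda>x. ennreal (indicator {0..1} x)))"
    by simp
  also have "\<dots> = (LINT t:{0..1}|lborel. f t)"
    by (subst integral_density) (auto simp: set_lebesgue_integral_def)
  finally show ?thesis .
qed

lemma integral_unif_quadratic:
  "(\<integral>t. a + b * t + c * t^2 \<partial>unif) = a + b / 2 + c / (3::real)"
proof -
  have "(\<integral>t. a + b * t + c * t^2 \<partial>unif) = (LINT t:{0..1}|lborel. a + b * t + c * t^2)"
    by (rule integral_unif) simp
  also have "\<dots> = (\<integral>t. (a + b * t + c * t^2) * indicator {0..1} t \<partial>lborel)"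
    by (simp add: set_lebesgue_integral_def mult.commute)
  also have "\<dots> = (a * 1 + b * 1^2 / 2 + c * 1^3 / 3) - (a * 0 + b * 0^2 / 2 + c * 0^3 / 3)"
    by (rule integral_FTC_Icc_real)
       (auto intro!: derivative_eq_intros continuous_intros simp: field_simps)
  finally show ?thesis by simp
qed

text \<open>Stated as a difference of values of \<open>min u\<close> at the two ends of the interval traversed by \<open>p + r t\<close>, so that
the contributions of adjacent intervals telescope. The form also covers \<open>r = 0\<close> and decreasing paths.\<close>
lemma measure_unif_affine:
  "r * measure unif {t. p + r * t \<le> u} = min u (p + r) - min u p"
proof -
  interpret prob_space unif by (rule prob_space_unif)
  have *: "measure unif A = measure lborel ({0..1} \<inter> A)" if "A \<in> sets borel" for A
    unfolding unif_def using that by (subst measure_uniform_measure) auto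
  have [measurable]: "{t. p + r * t \<le> u} \<in> sets borel" by measurable
  consider "r = 0" | "r > 0" | "r < 0" by linarith
  then show ?thesis
  proof cases
    case 2
    then have "{0..1} \<inter> {t. p + r * t \<le> u} = {0..min 1 ((u - p) / r)}"
      by (auto simp: field_simps)
    with 2 show ?thesis
      by (auto simp: * min_def field_simps split: if_splits)
  next
    case 3
    then have "{0..1} \<inter> {t. p + r * t \<le> u} = {max 0 ((u - p) / r)..1}"
      by (auto simp: field_simps)
    with 3 show ?thesis
      by (auto simp: * min_def max_def field_simps split: if_splits)
  qed simp
qed

definition coupling :: "(real \<times> real) measure \<Rightarrow> bool" where
  "coupling M \<longleftrightarrow> prob_space M \<and> sets M = sets borel \<and>
     distr M borel fst = unif \<and> distr M borel snd = unif"

lemma couplingD: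
  assumes "coupling M"
  shows "prob_space M" "sets M = sets borel" "distr M borel fst = unif" "distr M borel snd = unif"
  using assms by (auto simp: coupling_def)

lemma cdf_unif: "u \<in> {0..1} \<Longrightarrow> measure unif {..u} = u"
  using measure_unif_affine[of 1 0 u] by (auto simp: atMost_def)

text \<open>Prescribing the distribution function on \<open>[0,1]\<close> is enough: its values 0 and 1 at the ends force it
outside by monotonicity.\<close>
lemma distr_eq_unifI:
  assumes "prob_space M" "X \<in> borel_measurable M"
    and cdf: "\<And>u. u \<in> {0..1} \<Longrightarrow> measure M {\<omega> \<in> space M. X \<omega> \<le> u} = u"
  shows "distr M borel X = unif"
proof -
  note [measurable] = assms(2)
  interpret prob_space M by fact
  interpret U: prob_space unif by (rule prob_space_unif)
  have rd: "real_distribution (distr M borel X)" by simp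
  have rd': "real_distribution unif"
    by (intro real_distribution.intro real_distribution_axioms.intro prob_space_unif) simp_all
  have m: "measure (distr M borel X) {..u} = measure M {\<omega> \<in> space M. X \<omega> \<le> u}" for u
    by (subst measure_distr) (auto intro!: arg_cong[where f="measure M"])
  have "cdf (distr M borel X) u = cdf unif u" for u
  proof -
    consider "u \<in> {0..1}" | "u < 0" | "u > 1" by fastforce
    then show ?thesis
    proof cases
      case 1
      then show ?thesis unfolding cdf_def m by (simp add: cdf cdf_unif)
    next
      case 2
      have "measure M {\<omega> \<in> space M. X \<omega> \<le> u} \<le> measure M {\<omega> \<in> space M. X \<omega> \<le> 0}"
        using 2 by (intro finite_measure_mono) auto
      moreover have "measure unif {..u} \<le> measure unif {..0}"
        using 2 by (intro U.finite_measure_mono) auto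
      ultimately show ?thesis unfolding cdf_def m
        using cdf[of 0] cdf_unif[of 0]
          measure_nonneg[of M "{\<omega> \<in> space M. X \<omega> \<le> u}"] measure_nonneg[of unif "{..u}"]
        by simp
    next
      case 3
      have "measure M {\<omega> \<in> space M. X \<omega> \<le> 1} \<le> measure M {\<omega> \<in> space M. X \<omega> \<le> u}"
        using 3 by (intro finite_measure_mono) auto
      moreover have "measure unif {..1} \<le> measure unif {..u}"
        using 3 by (intro U.finite_measure_mono) auto
      ultimately show ?thesis unfolding cdf_def m
        using cdf[of 1] cdf_unif[of 1]
          prob_le_1[of "{\<omega> \<in> space M. X \<omega> \<le> u}"] U.prob_le_1[of "{..u}"]
        by simp
    qed
  qed
  then show ?thesis using cdf_unique[OF rd rd'] by auto
qed

lemma coupling_AE: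
  assumes "coupling M"
  shows "AE \<omega> in M. fst \<omega> \<in> {0..1} \<and> snd \<omega> \<in> {0..1}"
proof -
  note c = couplingD[OF assms]
  have [measurable_cong]: "sets M = sets (borel \<Otimes>\<^sub>M borel)" unfolding c(2) borel_prod ..
  have "AE t in distr M borel fst. t \<in> {0..1}" "AE t in distr M borel snd. t \<in> {0..1}"
    unfolding c using AE_unif by auto
  then have "AE \<omega> in M. fst \<omega> \<in> {0..1}" "AE \<omega> in M. snd \<omega> \<in> {0..1}"
    by (subst (asm) AE_distr_iff; simp)+
  then show ?thesis by auto
qed

lemma coupling_integrable:
  fixes \<phi> :: "real \<times> real \<Rightarrow> real"
  assumes "coupling M" "\<phi> \<in> borel_measurable borel"
    and "\<And>u v. u \<in> {0..1} \<Longrightarrow> v \<in> {0..1} \<Longrightarrow> \<bar>\<phi> (u, v)\<bar> \<le> B"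
  shows "integrable M \<phi>"
proof -
  note c = couplingD[OF assms(1)]
  interpret prob_space M by fact
  have "\<phi> \<in> borel_measurable M"
    using assms(2) by (subst measurable_cong_sets[OF c(2) refl])
  then show ?thesis
    by (intro integrable_const_bound[where B=B])
       (use coupling_AE[OF assms(1)] in eventually_elim, use assms(3) in auto)
qed

lemma coupling_margin:
  fixes f :: "real \<Rightarrow> real"
  assumes "coupling M" and [measurable]: "f \<in> borel_measurable borel"
  shows "(\<integral>\<omega>. f (fst \<omega>) \<partial>M) = (\<integral>t. f t \<partial>unif)" "(\<integral>\<omega>. f (snd \<omega>) \<partial>M) = (\<integral>t. f t \<partial>unif)"
proof -
  note c = couplingD[OF assms(1)]
  have [measurable_cong]: "sets M = sets (borel \<Otimes>\<^sub>M borel)" unfolding c(2) borel_prod ..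
  show "(\<integral>\<omega>. f (fst \<omega>) \<partial>M) = (\<integral>t. f t \<partial>unif)"
    by (subst c(3)[symmetric], subst integral_distr) auto
  show "(\<integral>\<omega>. f (snd \<omega>) \<partial>M) = (\<integral>t. f t \<partial>unif)"
    by (subst c(4)[symmetric], subst integral_distr) auto
qed


lemma coupling_measurable:
  assumes "coupling M"
  shows "fst \<in> borel_measurable M" "snd \<in> borel_measurable M"
proof -
  have [measurable_cong]: "sets M = sets (borel \<Otimes>\<^sub>M borel)"
    unfolding couplingD(2)[OF assms] borel_prod ..
  show "fst \<in> borel_measurable M" "snd \<in> borel_measurable M" by simp_all
qed

text \<open>The margin conditions only constrain the measure of quadrants with a corner on one of the lines \<open>u = 1\<close> and \<open>v = 1\<close>.
At the corner \<open>(1,1)\<close> they give measure 1, so no mass lies beyond these lines and the quadrants can be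
replaced by half planes.\<close>
lemma copula_imp_coupling:
  assumes "copula C"
  obtains M where "coupling M"
    "\<And>u v. u \<in> {0..1} \<Longrightarrow> v \<in> {0..1} \<Longrightarrow> C u v = bivariate_cdf M u v"
proof -
  from assms obtain M where M: "prob_space M" "sets M = sets borel"
      and C: "\<And>u v. u \<in> {0..1} \<Longrightarrow> v \<in> {0..1} \<Longrightarrow> C u v = bivariate_cdf M u v"
      and margins: "\<And>u. u \<in> {0..1} \<Longrightarrow> C u 1 = u" "\<And>v. v \<in> {0..1} \<Longrightarrow> C 1 v = v"
    unfolding copula_def by blast
  interpret prob_space M by fact
  have [measurable_cong]: "sets M = sets (borel \<Otimes>\<^sub>M borel)" unfolding M(2) borel_prod ..
  have rect: "{..u} \<times> {..v} \<in> sets M" for u v :: real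
    unfolding M(2) by (intro borel_closed closed_Times closed_atMost)
  have half: "{\<omega> \<in> space M. fst \<omega> \<le> u} \<in> sets M" "{\<omega> \<in> space M. snd \<omega> \<le> u} \<in> sets M" for u :: real
    by measurable
  have space: "space M = UNIV" using sets_eq_imp_space_eq[OF M(2)] by simp
  have "measure M ({..1} \<times> {..1}) = 1"
    using C[of 1 1] margins(1)[of 1] by (simp add: bivariate_cdf_def)
  then have "AE \<omega> in M. \<omega> \<in> {..1} \<times> {..1}"
    by (intro AE_prob_1) simp
  then have ae: "AE \<omega> in M. fst \<omega> \<le> 1 \<and> snd \<omega> \<le> 1" by eventually_elim auto
  have "distr M borel fst = unif"
  proof (rule distr_eq_unifI)
    fix u :: real assume u: "u \<in> {0..1}"
    have "measure M {\<omega> \<in> space M. fst \<omega> \<le> u} = measure M ({..u} \<times> {..1})"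
      by (intro finite_measure_eq_AE rect half) (use ae in eventually_elim, auto simp: space)
    also have "\<dots> = u" using C[of u 1] margins(1)[of u] u by (simp add: bivariate_cdf_def)
    finally show "measure M {\<omega> \<in> space M. fst \<omega> \<le> u} = u" .
  qed (fact, simp)
  moreover have "distr M borel snd = unif"
  proof (rule distr_eq_unifI)
    fix u :: real assume u: "u \<in> {0..1}"
    have "measure M {\<omega> \<in> space M. snd \<omega> \<le> u} = measure M ({..1} \<times> {..u})"
      by (intro finite_measure_eq_AE rect half) (use ae in eventually_elim, auto simp: space)
    also have "\<dots> = u" using C[of 1 u] margins(2)[of u] u by (simp add: bivariate_cdf_def)
    finally show "measure M {\<omega> \<in> space M. snd \<omega> \<le> u} = u" .
  qed (fact, simp)
  ultimately have "coupling M" using M by (simp add: coupling_def)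
  with C that show ?thesis by blast
qed

lemma coupling_imp_copula:
  assumes "coupling M"
  shows "copula (bivariate_cdf M)"
proof -
  note c = couplingD[OF assms]
  interpret prob_space M by fact
  have [measurable_cong]: "sets M = sets (borel \<Otimes>\<^sub>M borel)" unfolding c(2) borel_prod ..
  have rect: "{..u} \<times> {..v} \<in> sets M" for u v :: real
    unfolding c(2) by (intro borel_closed closed_Times closed_atMost)
  have half: "{\<omega> \<in> space M. fst \<omega> \<le> u} \<in> sets M" "{\<omega> \<in> space M. snd \<omega> \<le> u} \<in> sets M" for u :: real
    by measurable
  have space: "space M = UNIV" using sets_eq_imp_space_eq[OF c(2)] by simp
  have "measure M ({..u} \<times> {..1}) = u" if "u \<in> {0..1}" for u
  proof -
    have "measure M ({..u} \<times> {..1}) = measure M {\<omega> \<in> space M. fst \<omega> \<le> u}"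
      by (intro finite_measure_eq_AE rect half)
         (use coupling_AE[OF assms] in eventually_elim, auto simp: space)
    also have "\<dots> = measure (distr M borel fst) {..u}"
      by (subst measure_distr) (auto intro!: arg_cong[where f="measure M"])
    finally show ?thesis using that by (simp add: c cdf_unif)
  qed
  moreover have "measure M ({..1} \<times> {..u}) = u" if "u \<in> {0..1}" for u
  proof -
    have "measure M ({..1} \<times> {..u}) = measure M {\<omega> \<in> space M. snd \<omega> \<le> u}"
      by (intro finite_measure_eq_AE rect half)
         (use coupling_AE[OF assms] in eventually_elim, auto simp: space)
    also have "\<dots> = measure (distr M borel snd) {..u}"
      by (subst measure_distr) (auto intro!: arg_cong[where f="measure M"])
    finally show ?thesis using that by (simp add: c cdf_unif)
  qed
  ultimately show ?thesis
    unfolding copula_def using c by (auto simp: bivariate_cdf_def)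
qed

text \<open>Fubini for the indicator of \<open>R\<close>: integrating a distribution function over \<open>A\<close> amounts to averaging the size of
the part of \<open>A\<close> that dominates a random point.\<close>
lemma integral_measure_sections:
  fixes L :: "'a measure" and M :: "'b measure"
  assumes "sigma_finite_measure L" "prob_space M"
    and A[measurable]: "A \<in> sets L" and fin: "emeasure L A < \<infinity>"
    and R[measurable]: "Measurable.pred (L \<Otimes>\<^sub>M M) (\<lambda>(p, \<omega>). R p \<omega>)"
  shows "(LINT p:A|L. measure M {\<omega> \<in> space M. R p \<omega>}) =
         (\<integral>\<omega>. measure L {p \<in> space L. p \<in> A \<and> R p \<omega>} \<partial>M)"
proof -
  interpret L: sigma_finite_measure L by fact
  interpret M: prob_space M by fact
  interpret pair_sigma_finite L M ..
  let ?S = "{x \<in> space (L \<Otimes>\<^sub>M M). fst x \<in> A \<and> R (fst x) (snd x)}"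
  have R'[measurable]: "Measurable.pred (L \<Otimes>\<^sub>M M) (\<lambda>x. R (fst x) (snd x))"
    using R by (simp add: case_prod_beta')
  have S[measurable]: "?S \<in> sets (L \<Otimes>\<^sub>M M)" by measurable
  have "emeasure (L \<Otimes>\<^sub>M M) ?S \<le> emeasure (L \<Otimes>\<^sub>M M) (A \<times> space M)"
    by (intro emeasure_mono) (auto simp: space_pair_measure)
  also have "\<dots> < \<infinity>"
    using fin by (simp add: M.emeasure_pair_measure_Times M.emeasure_space_1)
  finally have "integrable (L \<Otimes>\<^sub>M M) (indicat_real ?S)"
    by (simp add: integrable_indicator_iff less_top[symmetric])
  then have int: "integrable (L \<Otimes>\<^sub>M M) (case_prod (\<lambda>p \<omega>. indicat_real ?S (p, \<omega>)))"
    by (simp add: case_prod_beta')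
  have "(LINT p:A|L. measure M {\<omega> \<in> space M. R p \<omega>}) = (\<integral>p. \<integral>\<omega>. indicat_real ?S (p, \<omega>) \<partial>M \<partial>L)"
    unfolding set_lebesgue_integral_def
  proof (intro Bochner_Integration.integral_cong refl)
    fix p assume p: "p \<in> space L"
    have "(\<integral>\<omega>. indicat_real ?S (p, \<omega>) \<partial>M) =
          (\<integral>\<omega>. indicat_real A p * indicat_real {\<omega> \<in> space M. R p \<omega>} \<omega> \<partial>M)"
      using p by (intro Bochner_Integration.integral_cong)
        (auto simp: space_pair_measure split: split_indicator)
    then show "indicat_real A p *\<^sub>R measure M {\<omega> \<in> space M. R p \<omega>} =
        (\<integral>\<omega>. indicat_real ?S (p, \<omega>) \<partial>M)"
      by (simp add: Int_absorb2)
  qed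
  also have "\<dots> = (\<integral>\<omega>. \<integral>p. indicat_real ?S (p, \<omega>) \<partial>L \<partial>M)"
    by (rule Fubini_integral[OF int, symmetric])
  also have "\<dots> = (\<integral>\<omega>. measure L {p \<in> space L. p \<in> A \<and> R p \<omega>} \<partial>M)"
  proof (intro Bochner_Integration.integral_cong refl)
    fix \<omega> assume w: "\<omega> \<in> space M"
    have "(\<integral>p. indicat_real ?S (p, \<omega>) \<partial>L) =
          (\<integral>p. indicat_real {p \<in> space L. p \<in> A \<and> R p \<omega>} p \<partial>L)"
      using w by (intro Bochner_Integration.integral_cong)
        (auto simp: space_pair_measure split: split_indicator)
    then show "(\<integral>p. indicat_real ?S (p, \<omega>) \<partial>L) = measure L {p \<in> space L. p \<in> A \<and> R p \<omega>}"
      by (simp add: Int_def conj_commute conj_left_commute)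
  qed
  finally show ?thesis .
qed

section \<open>Rank correlations as moments of the gap\<close>

definition mean_gap :: "(real \<times> real) measure \<Rightarrow> real" where
  "mean_gap M = (\<integral>\<omega>. \<bar>fst \<omega> - snd \<omega>\<bar> \<partial>M)"

definition mean_sq_gap :: "(real \<times> real) measure \<Rightarrow> real" where
  "mean_sq_gap M = (\<integral>\<omega>. (fst \<omega> - snd \<omega>)\<^sup>2 \<partial>M)"

lemma coupling_moments:
  assumes "coupling M"
  shows "(\<integral>\<omega>. fst \<omega> \<partial>M) = 1 / 2" "(\<integral>\<omega>. snd \<omega> \<partial>M) = 1 / 2"
    "(\<integral>\<omega>. (fst \<omega>)\<^sup>2 \<partial>M) = 1 / 3" "(\<integral>\<omega>. (snd \<omega>)\<^sup>2 \<partial>M) = 1 / 3"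
  using coupling_margin[OF assms, of "\<lambda>t. t"] coupling_margin[OF assms, of "\<lambda>t. t\<^sup>2"]
    integral_unif_quadratic[of 0 1 0] integral_unif_quadratic[of 0 0 1] by simp_all

text \<open>The upper bound comes from passing through the centre: \<open>\<bar>U - V\<bar> \<le> \<bar>U - 1/2\<bar> + \<bar>V - 1/2\<bar>\<close>, and each summand has
mean \<open>1/4\<close>.\<close>
lemma mean_gap_bounds:
  assumes "coupling M"
  shows "0 \<le> mean_gap M" "mean_gap M \<le> 1/2" "0 \<le> mean_sq_gap M"
proof -
  show "0 \<le> mean_gap M" "0 \<le> mean_sq_gap M" by (simp_all add: mean_gap_def mean_sq_gap_def)
  have i: "integrable M (\<lambda>\<omega>. \<bar>fst \<omega> - 1/2\<bar>)" "integrable M (\<lambda>\<omega>. \<bar>snd \<omega> - 1/2\<bar>)"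
    "integrable M (\<lambda>\<omega>. \<bar>fst \<omega> - snd \<omega>\<bar>)"
    by (auto intro!: coupling_integrable[OF assms, where B=1] borel_measurable_continuous_onI continuous_intros)
  have "(\<lambda>t::real. \<bar>t - 1/2\<bar>) \<in> borel_measurable borel" by simp
  note margin = coupling_margin[OF assms this]
  have half: "(\<integral>t. \<bar>t - 1/2\<bar> \<partial>unif) = 1/4"
  proof -
    have left: "has_bochner_integral lborel (\<lambda>t. (1/2 - t) * indicator {0..1/2} t)
        ((1/2 * (1/2) - (1/2)\<^sup>2 / 2) - (1/2 * 0 - 0\<^sup>2 / 2 :: real))"
      by (rule has_bochner_integral_FTC_Icc_real)
         (auto intro!: derivative_eq_intros continuous_intros)
    have right: "has_bochner_integral lborel (\<lambda>t. (t - 1/2) * indicator {1/2..1} t)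
        ((1\<^sup>2 / 2 - 1/2 * 1) - ((1/2)\<^sup>2 / 2 - 1/2 * (1/2) :: real))"
      by (rule has_bochner_integral_FTC_Icc_real)
         (auto intro!: derivative_eq_intros continuous_intros)
    have sum: "has_bochner_integral lborel
        (\<lambda>t. (1/2 - t) * indicator {0..1/2} t + (t - 1/2) * indicator {1/2..1} t) (1/4 :: real)"
      using has_bochner_integral_add[OF left right] by (simp add: power2_eq_square)
    have "(\<integral>t. \<bar>t - 1/2\<bar> \<partial>unif) = (LINT t:{0..1}|lborel. \<bar>t - 1/2\<bar>)"
      by (rule integral_unif) simp
    also have "\<dots> = (\<integral>t. (1/2 - t) * indicator {0..1/2} t + (t - 1/2) * indicator {1/2..1} t \<partial>lborel)"
      unfolding set_lebesgue_integral_def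
      by (intro Bochner_Integration.integral_cong) (auto split: split_indicator)
    also have "\<dots> = 1/4" using sum by (rule has_bochner_integral_integral_eq)
    finally show ?thesis .
  qed
  have "mean_gap M \<le> (\<integral>\<omega>. \<bar>fst \<omega> - 1/2\<bar> + \<bar>snd \<omega> - 1/2\<bar> \<partial>M)"
    unfolding mean_gap_def using i by (intro integral_mono) auto
  also have "\<dots> = 1/2" using i by (simp add: margin half)
  finally show "mean_gap M \<le> 1/2" .
qed

text \<open>The inner section is \<open>[max(U,V), 1]\<close>, and \<open>max(U,V) = (U + V + \<bar>U - V\<bar>)/2\<close> brings in the gap.\<close>
lemma footrule_coupling:
  assumes M: "coupling M"
    and C: "\<And>u v. u \<in> {0..1} \<Longrightarrow> v \<in> {0..1} \<Longrightarrow> C u v = bivariate_cdf M u v"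
  shows "spearman_footrule C = 1 - 3 * mean_gap M"
proof -
  note c = couplingD[OF M]
  interpret prob_space M by fact
  have [measurable_cong]: "sets M = sets (borel \<Otimes>\<^sub>M borel)" unfolding c(2) borel_prod ..
  have space: "space M = UNIV" using sets_eq_imp_space_eq[OF c(2)] by simp
  have int: "integrable M fst" "integrable M snd" "integrable M (\<lambda>\<omega>. \<bar>fst \<omega> - snd \<omega>\<bar>)"
    by (auto intro!: coupling_integrable[OF M, where B=1] borel_measurable_continuous_onI continuous_intros)
  have "(LINT t:{0..1}|lborel. C t t) =
        (LINT t:{0..1}|lborel. measure M {\<omega> \<in> space M. fst \<omega> \<le> t \<and> snd \<omega> \<le> t})"
    by (rule set_lebesgue_integral_cong)
       (auto simp: C bivariate_cdf_def space intro!: arg_cong[where f="measure M"])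
  also have "\<dots> = (\<integral>\<omega>. measure lborel {t \<in> space lborel. t \<in> {0..1} \<and> fst \<omega> \<le> t \<and> snd \<omega> \<le> t} \<partial>M)"
    by (rule integral_measure_sections) (auto intro: lborel.sigma_finite_measure_axioms c)
  also have "\<dots> = (\<integral>\<omega>. 1 - (fst \<omega> + snd \<omega> + \<bar>fst \<omega> - snd \<omega>\<bar>) / 2 \<partial>M)"
  proof (rule integral_cong_AE)
    show "AE \<omega> in M. measure lborel {t \<in> space lborel. t \<in> {0..1} \<and> fst \<omega> \<le> t \<and> snd \<omega> \<le> t} =
        1 - (fst \<omega> + snd \<omega> + \<bar>fst \<omega> - snd \<omega>\<bar>) / 2"
      using coupling_AE[OF M]
    proof eventually_elim
      case (elim \<omega>)
      then have "{t \<in> space lborel. t \<in> {0..1} \<and> fst \<omega> \<le> t \<and> snd \<omega> \<le> t} = {max (fst \<omega>) (snd \<omega>)..1}"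
        by auto
      then show ?case using elim by auto
    qed
    show "(\<lambda>\<omega>. measure lborel {t \<in> space lborel. t \<in> {0..1} \<and> fst \<omega> \<le> t \<and> snd \<omega> \<le> t}) \<in> borel_measurable M"
      by measurable
  qed measurable
  also have "\<dots> = 1 - (1/2 + 1/2 + mean_gap M) / 2"
    using int by (simp add: coupling_moments[OF M] mean_gap_def prob_space)
  finally show ?thesis by (simp add: spearman_footrule_def field_simps)
qed

text \<open>The inner section is the rectangle \<open>[U,1] \<times> [V,1]\<close> of area \<open>(1 - U)(1 - V)\<close>; the product \<open>UV\<close> is expressed by
\<open>(U - V)\<^sup>2\<close> and by squares with known means.\<close>
lemma rho_coupling:
  assumes M: "coupling M"
    and C: "\<And>u v. u \<in> {0..1} \<Longrightarrow> v \<in> {0..1} \<Longrightarrow> C u v = bivariate_cdf M u v"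
  shows "spearman_rho C = 1 - 6 * mean_sq_gap M"
proof -
  note c = couplingD[OF M]
  interpret prob_space M by fact
  have [measurable_cong]: "sets M = sets (borel \<Otimes>\<^sub>M borel)" unfolding c(2) borel_prod ..
  have [measurable_cong]: "sets (lborel :: (real \<times> real) measure) = sets (borel \<Otimes>\<^sub>M borel)"
    unfolding borel_prod by simp
  have space: "space M = UNIV" using sets_eq_imp_space_eq[OF c(2)] by simp
  have box: "emeasure lborel ({a..b} \<times> {a'..b'}) = ennreal ((b - a) * (b' - a'))"
    if "a \<le> b" "a' \<le> b'" for a b a' b' :: real
    unfolding lborel_prod[symmetric] using that
    by (subst lborel.emeasure_pair_measure_Times) (auto simp: ennreal_mult)
  have square: "{0..1} \<times> {0..1} \<in> sets (borel :: (real \<times> real) measure)"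
    by (intro borel_closed closed_Times closed_atLeastAtMost)
  have int: "integrable M fst" "integrable M snd" "integrable M (\<lambda>\<omega>. (fst \<omega>)\<^sup>2)"
      "integrable M (\<lambda>\<omega>. (snd \<omega>)\<^sup>2)" "integrable M (\<lambda>\<omega>. (fst \<omega> - snd \<omega>)\<^sup>2)"
    by (auto intro!: coupling_integrable[OF M, where B=1] borel_measurable_continuous_onI continuous_intros simp: power_le_one abs_square_le_1)
  have "(LINT p:{0..1}\<times>{0..1}|lborel. C (fst p) (snd p)) =
        (LINT p:{0..1}\<times>{0..1}|lborel. measure M {\<omega> \<in> space M. fst \<omega> \<le> fst p \<and> snd \<omega> \<le> snd p})"
    by (rule set_lebesgue_integral_cong)
       (auto simp: C bivariate_cdf_def space square intro!: arg_cong[where f="measure M"])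
  also have "\<dots> = (\<integral>\<omega>. measure lborel
      {p \<in> space lborel. p \<in> {0..1}\<times>{0..1} \<and> fst \<omega> \<le> fst p \<and> snd \<omega> \<le> snd p} \<partial>M)"
    by (rule integral_measure_sections)
       (auto intro: lborel.sigma_finite_measure_axioms c simp: box square)
  also have "\<dots> = (\<integral>\<omega>. 1 - fst \<omega> - snd \<omega> + ((fst \<omega>)\<^sup>2 + (snd \<omega>)\<^sup>2 - (fst \<omega> - snd \<omega>)\<^sup>2) / 2 \<partial>M)"
  proof (rule integral_cong_AE)
    show "AE \<omega> in M. measure lborel
        {p \<in> space lborel. p \<in> {0..1}\<times>{0..1} \<and> fst \<omega> \<le> fst p \<and> snd \<omega> \<le> snd p} =
        1 - fst \<omega> - snd \<omega> + ((fst \<omega>)\<^sup>2 + (snd \<omega>)\<^sup>2 - (fst \<omega> - snd \<omega>)\<^sup>2) / 2"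
      using coupling_AE[OF M]
    proof eventually_elim
      case (elim \<omega>)
      then have *: "{p \<in> space lborel. p \<in> {0..1}\<times>{0..1} \<and> fst \<omega> \<le> fst p \<and> snd \<omega> \<le> snd p} =
          {fst \<omega>..1} \<times> {snd \<omega>..1}"
        by auto
      have "measure lborel ({fst \<omega>..1} \<times> {snd \<omega>..1}) = (1 - fst \<omega>) * (1 - snd \<omega>)"
        using elim by (simp add: measure_def box)
      then show ?case unfolding * by (simp add: power2_eq_square algebra_simps)
    qed
    show "(\<lambda>\<omega>. measure lborel
        {p \<in> space lborel. p \<in> {0..1}\<times>{0..1} \<and> fst \<omega> \<le> fst p \<and> snd \<omega> \<le> snd p}) \<in> borel_measurable M"
      by measurable
  qed measurable
  also have "\<dots> = 1 - 1/2 - 1/2 + (1/3 + 1/3 - mean_sq_gap M) / 2"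
    using int by (simp add: coupling_moments[OF M] mean_sq_gap_def prob_space)
  finally show ?thesis by (simp add: spearman_rho_def field_simps)
qed

lemma range_eq_gap_moments:
  "{(spearman_rho C, spearman_footrule C) |C. copula C} =
   {(1 - 6 * mean_sq_gap M, 1 - 3 * mean_gap M) |M. coupling M}"
proof (intro set_eqI iffI; clarsimp)
  fix C assume "copula C"
  then obtain M where "coupling M"
      "\<And>u v. u \<in> {0..1} \<Longrightarrow> v \<in> {0..1} \<Longrightarrow> C u v = bivariate_cdf M u v"
    by (rule copula_imp_coupling) blast
  then show "\<exists>M. spearman_rho C = 1 - 6 * mean_sq_gap M \<and>
      spearman_footrule C = 1 - 3 * mean_gap M \<and> coupling M"
    using rho_coupling footrule_coupling by blast
next
  fix M assume M: "coupling M"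
  show "\<exists>C. 1 - 6 * mean_sq_gap M = spearman_rho C \<and>
      1 - 3 * mean_gap M = spearman_footrule C \<and> copula C"
    using rho_coupling[OF M refl] footrule_coupling[OF M refl] coupling_imp_copula[OF M] by metis
qed


section \<open>Couplings built as mixtures\<close>

lemma finite_mixture:
  fixes K :: "'i \<Rightarrow> (real \<times> real) measure"
  assumes I: "finite I" and w: "\<And>i. i \<in> I \<Longrightarrow> 0 \<le> w i" "(\<Sum>i\<in>I. w i) = 1"
    and K: "\<And>i. i \<in> I \<Longrightarrow> prob_space (K i)" "\<And>i. i \<in> I \<Longrightarrow> sets (K i) = sets borel"
  obtains M where "prob_space M" "sets M = sets borel"
    "\<And>\<phi> B. \<phi> \<in> borel_measurable borel \<Longrightarrow> (\<And>x. \<bar>\<phi> x\<bar> \<le> B) \<Longrightarrow>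
       (\<integral>x. \<phi> x \<partial>M) = (\<Sum>i\<in>I. w i * (\<integral>x. (\<phi> x :: real) \<partial>K i))"
proof -
  let ?P = "point_measure I w"
  interpret P: prob_space ?P using I w by (intro prob_space_point_measure) auto
  have sp: "space ?P = I" by (simp add: space_point_measure)
  have N[measurable]: "K \<in> measurable ?P (subprob_algebra borel)"
    using K by (auto simp: space_subprob_algebra prob_space_imp_subprob_space)
  have "prob_space (?P \<bind> K)"
    by (rule P.prob_space_bind[OF _ N]) (auto simp: sp K intro!: AE_I2)
  moreover have "sets (?P \<bind> K) = sets borel"
    by (rule sets_bind_measurable[OF N]) (rule P.not_empty)
  moreover have "(\<integral>x. \<phi> x \<partial>(?P \<bind> K)) = (\<Sum>i\<in>I. w i * (\<integral>x. \<phi> x \<partial>K i))"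
    if "\<phi> \<in> borel_measurable borel" "\<And>x. \<bar>\<phi> x\<bar> \<le> B" for \<phi> :: "real \<times> real \<Rightarrow> real" and B
  proof -
    have "(\<integral>x. \<phi> x \<partial>(?P \<bind> K)) = (\<integral>i. \<integral>x. \<phi> x \<partial>K i \<partial>?P)"
      by (rule integral_bind[OF that(1) _ N, where B=B and B'=1])
         (use that(2) K in \<open>auto simp: sp P.finite_measure_axioms prob_space.emeasure_space_1 intro!: AE_I2\<close>)
    then show ?thesis using I w by (simp add: lebesgue_integral_point_measure_finite)
  qed
  ultimately show ?thesis using that by blast
qed

text \<open>Uniform margins are a condition on the mixture, so the components may live on small pieces. Since all mass lies in the unit
square, integrals may be computed for integrands that are bounded there, such as powers of the gap.\<close>
lemma mixture_coupling:
  fixes K :: "'i \<Rightarrow> (real \<times> real) measure"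
  assumes I: "finite I" and w: "\<And>i. i \<in> I \<Longrightarrow> 0 \<le> w i" "(\<Sum>i\<in>I. w i) = 1"
    and K: "\<And>i. i \<in> I \<Longrightarrow> prob_space (K i)" "\<And>i. i \<in> I \<Longrightarrow> sets (K i) = sets borel"
    and square: "\<And>i. i \<in> I \<Longrightarrow> AE \<omega> in K i. \<omega> \<in> {0..1} \<times> {0..1}"
    and margins: "\<And>u. u \<in> {0..1} \<Longrightarrow> (\<Sum>i\<in>I. w i * measure (K i) {\<omega>. fst \<omega> \<le> u}) = u"
      "\<And>u. u \<in> {0..1} \<Longrightarrow> (\<Sum>i\<in>I. w i * measure (K i) {\<omega>. snd \<omega> \<le> u}) = u"
  obtains M where "coupling M"
    "\<And>\<phi> B. \<phi> \<in> borel_measurable borel \<Longrightarrow>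
       (\<And>u v. u \<in> {0..1} \<Longrightarrow> v \<in> {0..1} \<Longrightarrow> \<bar>\<phi> (u, v)\<bar> \<le> B) \<Longrightarrow>
       (\<integral>\<omega>. \<phi> \<omega> \<partial>M) = (\<Sum>i\<in>I. w i * (\<integral>\<omega>. (\<phi> \<omega> :: real) \<partial>K i))"
proof -
  obtain M where M: "prob_space M" "sets M = sets borel"
    and int: "\<And>\<phi> B. \<phi> \<in> borel_measurable borel \<Longrightarrow> (\<And>x. \<bar>\<phi> x\<bar> \<le> B) \<Longrightarrow>
       (\<integral>x. \<phi> x \<partial>M) = (\<Sum>i\<in>I. w i * (\<integral>x. (\<phi> x :: real) \<partial>K i))"
    using finite_mixture[of I w K, OF I w K] by blast
  interpret M: prob_space M by fact
  have closed: "{\<omega>. fst \<omega> \<le> u} \<in> sets borel" "{\<omega>. snd \<omega> \<le> u} \<in> sets borel" for u :: real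
    by (intro borel_closed closed_Collect_le continuous_intros)+
  have meas: "measure M A = (\<Sum>i\<in>I. w i * measure (K i) A)" if "A \<in> sets borel" for A
  proof -
    have "(\<integral>x. indicat_real A x \<partial>M) = (\<Sum>i\<in>I. w i * (\<integral>x. indicat_real A x \<partial>K i))"
      by (rule int[where B=1]) (use that in auto)
    moreover have "space M = UNIV" "i \<in> I \<Longrightarrow> space (K i) = UNIV" for i
      using sets_eq_imp_space_eq[OF M(2)] sets_eq_imp_space_eq[OF K(2)] by simp_all
    ultimately show ?thesis by simp
  qed
  have space: "space M = UNIV" using sets_eq_imp_space_eq[OF M(2)] by simp
  have mble: "fst \<in> borel_measurable M" "snd \<in> borel_measurable M"
    unfolding measurable_cong_sets[OF M(2) refl]
    by (intro borel_measurable_continuous_onI continuous_intros)+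
  have c: "coupling M"
    unfolding coupling_def using M mble
    by (auto intro!: distr_eq_unifI simp: space meas[OF closed(1)] meas[OF closed(2)] margins)
  moreover have "(\<integral>\<omega>. \<phi> \<omega> \<partial>M) = (\<Sum>i\<in>I. w i * (\<integral>\<omega>. \<phi> \<omega> \<partial>K i))"
    if \<phi>: "\<phi> \<in> borel_measurable borel" and B: "\<And>u v. u \<in> {0..1} \<Longrightarrow> v \<in> {0..1} \<Longrightarrow> \<bar>\<phi> (u, v)\<bar> \<le> B"
    for \<phi> :: "real \<times> real \<Rightarrow> real" and B
  proof -
    let ?\<psi> = "\<lambda>x. indicator ({0..1} \<times> {0..1}) x * \<phi> x"
    have \<psi>: "?\<psi> \<in> borel_measurable borel"
      by (intro borel_measurable_times \<phi> borel_measurable_indicator borel_closed closed_Times) auto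
    have "\<bar>?\<psi> x\<bar> \<le> \<bar>B\<bar>" for x
      using B by (cases x) (force split: split_indicator)
    then have "(\<integral>x. ?\<psi> x \<partial>M) = (\<Sum>i\<in>I. w i * (\<integral>x. ?\<psi> x \<partial>K i))"
      using int[OF \<psi>] by blast
    moreover have "(\<integral>x. ?\<psi> x \<partial>M) = (\<integral>x. \<phi> x \<partial>M)"
    proof (rule integral_cong_AE)
      show "AE x in M. ?\<psi> x = \<phi> x"
        using coupling_AE[OF c] by eventually_elim (auto simp: mem_Times_iff)
    qed (use \<psi> \<phi> measurable_cong_sets[OF M(2) refl] in auto)
    moreover have "(\<integral>x. ?\<psi> x \<partial>K i) = (\<integral>x. \<phi> x \<partial>K i)" if "i \<in> I" for i
    proof (rule integral_cong_AE)
      show "AE x in K i. ?\<psi> x = \<phi> x"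
        using square[OF that] by eventually_elim auto
    qed (use \<psi> \<phi> measurable_cong_sets[OF K(2)[OF that] refl] in auto)
    ultimately show ?thesis by simp
  qed
  ultimately show ?thesis using that by blast
qed

lemma measure_coupling_le:
  assumes "coupling M" "u \<in> {0..1}"
  shows "measure M {\<omega>. fst \<omega> \<le> u} = u" "measure M {\<omega>. snd \<omega> \<le> u} = u"
proof -
  note c = couplingD[OF assms(1)]
  have space: "space M = UNIV" using sets_eq_imp_space_eq[OF c(2)] by simp
  have "measure (distr M borel X) {..u} = measure M {\<omega>. X \<omega> \<le> u}" if "X \<in> borel_measurable M" for X
    using that by (subst measure_distr) (auto intro!: arg_cong[where f="measure M"] simp: space)
  from this[of fst] this[of snd] show "measure M {\<omega>. fst \<omega> \<le> u} = u" "measure M {\<omega>. snd \<omega> \<le> u} = u"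
    using assms(2) coupling_measurable[OF assms(1)] by (simp_all add: c cdf_unif)
qed

lemma gap_bounded:
  assumes "u \<in> {0..1}" "v \<in> {0..1::real}"
  shows "\<bar>\<bar>u - v\<bar>\<bar> \<le> 1" "\<bar>(u - v)\<^sup>2\<bar> \<le> 1"
  using assms by (auto simp: abs_square_le_1)

lemma gap_measurable:
  "(\<lambda>\<omega>. \<bar>fst \<omega> - snd \<omega>\<bar>) \<in> borel_measurable (borel :: (real \<times> real) measure)"
  "(\<lambda>\<omega>. (fst \<omega> - snd \<omega>)\<^sup>2) \<in> borel_measurable (borel :: (real \<times> real) measure)"
  by (intro borel_measurable_continuous_onI continuous_intros)+

lemma coupling_convex:
  assumes "coupling M1" "coupling M2" "0 \<le> \<theta>" "\<theta> \<le> 1"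
  obtains M where "coupling M" "mean_gap M = \<theta> * mean_gap M1 + (1 - \<theta>) * mean_gap M2"
    "mean_sq_gap M = \<theta> * mean_sq_gap M1 + (1 - \<theta>) * mean_sq_gap M2"
proof -
  let ?K = "\<lambda>b. if b then M1 else M2" and ?w = "\<lambda>b. if b then \<theta> else 1 - \<theta>"
  have c: "coupling (?K b)" for b using assms by auto
  obtain M where M: "coupling M" and int: "\<And>\<phi> B. \<phi> \<in> borel_measurable borel \<Longrightarrow>
       (\<And>u v. u \<in> {0..1} \<Longrightarrow> v \<in> {0..1} \<Longrightarrow> \<bar>\<phi> (u, v)\<bar> \<le> B) \<Longrightarrow>
       (\<integral>\<omega>. \<phi> \<omega> \<partial>M) = (\<Sum>b\<in>UNIV. ?w b * (\<integral>\<omega>. (\<phi> \<omega> :: real) \<partial>?K b))"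
  proof (rule mixture_coupling[of UNIV ?w ?K])
    show "AE \<omega> in ?K b. \<omega> \<in> {0..1} \<times> {0..1}" for b
      using coupling_AE[OF c[of b]] by eventually_elim (auto simp: mem_Times_iff)
  qed (use c couplingD(1,2)[OF c] assms(3,4) in
      \<open>auto simp: UNIV_bool measure_coupling_le[OF assms(1)] measure_coupling_le[OF assms(2)] algebra_simps\<close>)
  show ?thesis
    by (rule that[OF M])
       (use int[OF gap_measurable(1), of 1] int[OF gap_measurable(2), of 1] gap_bounded
         in \<open>auto simp: mean_gap_def mean_sq_gap_def UNIV_bool\<close>)
qed

text \<open>A coupling supported on finitely many curves \<open>h\<close>, each traversed uniformly and with total mass \<open>w\<close>. The
coupling is symmetrized, half of each curve being reflected in the diagonal. Hence only the average of
the two margins has to be uniform, and symmetric integrands do not notice the reflection.\<close>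
lemma path_coupling:
  fixes xs :: "(real \<times> (real \<Rightarrow> real \<times> real)) list"
  assumes weight: "\<And>w h. (w, h) \<in> set xs \<Longrightarrow> 0 \<le> w" "(\<Sum>(w, h)\<leftarrow>xs. w) = 1"
    and path: "\<And>w h. (w, h) \<in> set xs \<Longrightarrow> continuous_on UNIV h"
      "\<And>w h t. (w, h) \<in> set xs \<Longrightarrow> t \<in> {0..1} \<Longrightarrow> h t \<in> {0..1} \<times> {0..1}"
    and margin: "\<And>u. u \<in> {0..1} \<Longrightarrow>
      (\<Sum>(w, h)\<leftarrow>xs. w * (measure unif {t. fst (h t) \<le> u} + measure unif {t. snd (h t) \<le> u})) = 2 * u"
  obtains M where "coupling M"
    "\<And>\<phi> B. \<phi> \<in> borel_measurable borel \<Longrightarrow>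
       (\<And>u v. u \<in> {0..1} \<Longrightarrow> v \<in> {0..1} \<Longrightarrow> \<bar>\<phi> (u, v)\<bar> \<le> B) \<Longrightarrow> (\<And>u v. \<phi> (u, v) = \<phi> (v, u)) \<Longrightarrow>
       (\<integral>\<omega>. \<phi> \<omega> \<partial>M) = (\<Sum>(w, h)\<leftarrow>xs. w * (\<integral>t. (\<phi> (h t) :: real) \<partial>unif))"
proof -
  interpret U: prob_space unif by (rule prob_space_unif)
  let ?I = "{..<length xs} \<times> (UNIV :: bool set)"
  define w where "w i = fst (xs ! i)" for i
  define h where "h i = snd (xs ! i)" for i
  \<comment> \<open>The flag \<open>b\<close> tells whether the \<open>i\<close>-th curve is traversed as it is or reflected.\<close>
  define g where "g = (\<lambda>(i, b) t. if b then h i t else prod.swap (h i t))"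
  define K where "K x = distr unif borel (g x)" for x
  have mem: "(w i, h i) \<in> set xs" if "i < length xs" for i
    using that by (simp add: w_def h_def)
  have list: "(\<Sum>(w, h)\<leftarrow>xs. F w h) = (\<Sum>i<length xs. F (w i) (h i))" for F :: "_ \<Rightarrow> _ \<Rightarrow> real"
    by (simp add: sum_list_sum_nth w_def h_def case_prod_beta' atLeast0LessThan)
  have split: "(\<Sum>x\<in>?I. F x) = (\<Sum>i<length xs. F (i, True) + F (i, False))" for F :: "_ \<Rightarrow> real"
    by (subst sum.cartesian_product') (simp add: UNIV_bool add.commute)
  have cont: "continuous_on UNIV (h i)" if "i < length xs" for i
    using path(1)[OF mem[OF that]] .
  have contg: "continuous_on UNIV (g x)" if "x \<in> ?I" for x
  proof -
    have "continuous_on UNIV (\<lambda>t. (snd (h (fst x) t), fst (h (fst x) t)))"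
      using that cont by (intro continuous_intros) auto
    with that cont show ?thesis
      by (cases x; cases "snd x") (auto simp: g_def prod.swap_def)
  qed
  have g[measurable]: "g x \<in> borel_measurable borel" if "x \<in> ?I" for x
    using contg[OF that] by (rule borel_measurable_continuous_onI)
  have g_unif: "g x \<in> measurable unif borel" if "x \<in> ?I" for x
    using g[OF that] by (simp cong: measurable_cong_sets)
  have gsq: "g x t \<in> {0..1} \<times> {0..1}" if "x \<in> ?I" "t \<in> {0..1}" for x t
    using that path(2)[OF mem, of "fst x" t] by (cases x) (auto simp: g_def mem_Times_iff)
  have closed: "{\<omega>. fst \<omega> \<le> u} \<in> sets borel" "{\<omega>. snd \<omega> \<le> u} \<in> sets borel" for u :: real
    by (intro borel_closed closed_Collect_le continuous_intros)+
  have mK: "measure (K x) {\<omega>. X \<omega> \<le> u} = measure unif {t. X (g x t) \<le> u}"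
    if "x \<in> ?I" "{\<omega>. X \<omega> \<le> u} \<in> sets borel" for x X and u :: real
    unfolding K_def using that by (subst measure_distr[OF g_unif]) (auto simp: vimage_def)
  have intK: "(\<integral>\<omega>. \<phi> \<omega> \<partial>K x) = (\<integral>t. \<phi> (g x t) \<partial>unif)"
    if "x \<in> ?I" "\<phi> \<in> borel_measurable borel" for x and \<phi> :: "real \<times> real \<Rightarrow> real"
    unfolding K_def using that by (intro integral_distr g_unif) auto
  obtain M where M: "coupling M" and int: "\<And>\<phi> B. \<phi> \<in> borel_measurable borel \<Longrightarrow>
       (\<And>u v. u \<in> {0..1} \<Longrightarrow> v \<in> {0..1} \<Longrightarrow> \<bar>\<phi> (u, v)\<bar> \<le> B) \<Longrightarrow>
       (\<integral>\<omega>. \<phi> \<omega> \<partial>M) = (\<Sum>x\<in>?I. (w (fst x) / 2) * (\<integral>\<omega>. (\<phi> \<omega> :: real) \<partial>K x))"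
  proof (rule mixture_coupling[of ?I "\<lambda>x. w (fst x) / 2" K])
    show "finite ?I" by simp
    show "0 \<le> w (fst x) / 2" if "x \<in> ?I" for x
      using weight(1)[OF mem, of "fst x"] that by auto
    show "(\<Sum>x\<in>?I. w (fst x) / 2) = 1"
      using weight(2) unfolding split list by simp
    show "prob_space (K x)" if "x \<in> ?I" for x
      unfolding K_def by (rule U.prob_space_distr[OF g_unif[OF that]])
    show "sets (K x) = sets borel" for x by (simp add: K_def)
    show "AE \<omega> in K x. \<omega> \<in> {0..1} \<times> {0..1}" if "x \<in> ?I" for x
    proof -
      have "{\<omega> \<in> space borel. \<omega> \<in> {0..1::real} \<times> {0..1::real}} \<in> sets borel"
        by (simp del: mem_Times_iff) (intro borel_closed closed_Times closed_atLeastAtMost)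
      moreover have "AE t in unif. g x t \<in> {0..1} \<times> {0..1}"
        using AE_unif by eventually_elim (rule gsq[OF that])
      ultimately show ?thesis
        unfolding K_def by (subst AE_distr_iff[OF g_unif[OF that]])
    qed
    show "(\<Sum>x\<in>?I. w (fst x) / 2 * measure (K x) {\<omega>. fst \<omega> \<le> u}) = u" if "u \<in> {0..1}" for u
    proof -
      have "(\<Sum>x\<in>?I. w (fst x) / 2 * measure (K x) {\<omega>. fst \<omega> \<le> u}) =
        (\<Sum>x\<in>?I. w (fst x) / 2 * measure unif {t. fst (g x t) \<le> u})"
        by (intro sum.cong refl) (simp add: mK closed)
      also have "\<dots> = (\<Sum>(w, h)\<leftarrow>xs. w * (measure unif {t. fst (h t) \<le> u} + measure unif {t. snd (h t) \<le> u})) / 2"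
        unfolding split list by (simp add: g_def sum_divide_distrib field_simps)
      finally show ?thesis using margin[OF that] by simp
    qed
    show "(\<Sum>x\<in>?I. w (fst x) / 2 * measure (K x) {\<omega>. snd \<omega> \<le> u}) = u" if "u \<in> {0..1}" for u
    proof -
      have "(\<Sum>x\<in>?I. w (fst x) / 2 * measure (K x) {\<omega>. snd \<omega> \<le> u}) =
        (\<Sum>x\<in>?I. w (fst x) / 2 * measure unif {t. snd (g x t) \<le> u})"
        by (intro sum.cong refl) (simp add: mK closed)
      also have "\<dots> = (\<Sum>(w, h)\<leftarrow>xs. w * (measure unif {t. fst (h t) \<le> u} + measure unif {t. snd (h t) \<le> u})) / 2"
        unfolding split list by (simp add: g_def sum_divide_distrib field_simps)
      finally show ?thesis using margin[OF that] by simp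
    qed
  qed blast
  show ?thesis
  proof (rule that[OF M])
    fix \<phi> :: "real \<times> real \<Rightarrow> real" and B
    assume \<phi>: "\<phi> \<in> borel_measurable borel"
      and B: "\<And>u v. u \<in> {0..1} \<Longrightarrow> v \<in> {0..1} \<Longrightarrow> \<bar>\<phi> (u, v)\<bar> \<le> B" and sym: "\<And>u v. \<phi> (u, v) = \<phi> (v, u)"
    have sw: "\<phi> (prod.swap x) = \<phi> x" for x by (cases x) (simp add: sym)
    have "(\<integral>\<omega>. \<phi> \<omega> \<partial>M) = (\<Sum>x\<in>?I. (w (fst x) / 2) * (\<integral>\<omega>. \<phi> \<omega> \<partial>K x))"
      by (rule int[OF \<phi> B])
    also have "\<dots> = (\<Sum>x\<in>?I. (w (fst x) / 2) * (\<integral>t. \<phi> (g x t) \<partial>unif))"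
      by (intro sum.cong refl) (simp add: intK \<phi>)
    also have "\<dots> = (\<Sum>(w, h)\<leftarrow>xs. w * (\<integral>t. \<phi> (h t) \<partial>unif))"
      unfolding split list by (simp add: g_def sw)
    finally show "(\<integral>\<omega>. \<phi> \<omega> \<partial>M) = (\<Sum>(w, h)\<leftarrow>xs. w * (\<integral>t. \<phi> (h t) \<partial>unif))" .
  qed
qed


section \<open>Optimality by duality\<close>

text \<open>Weak duality together with complementary slackness. The integral of \<open>f(U) + f(V)\<close> is twice the mean of \<open>f\<close> for
every coupling. It bounds the cost of any coupling from below and equals the cost of the one built from
the paths, on which the dual inequality is tight. The sign \<open>\<sigma>\<close> selects minimization (\<open>1\<close>) or
maximization (\<open>-1\<close>) of the square gap, and \<open>2c\<close> is the Lagrange multiplier for the mean gap.\<close>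
lemma gap_optimal:
  fixes xs :: "(real \<times> (real \<Rightarrow> real \<times> real)) list" and \<sigma> c :: real and f :: "real \<Rightarrow> real"
  defines "k \<equiv> \<lambda>u v. \<sigma> * (\<bar>u - v\<bar>\<^sup>2 - 2 * c * \<bar>u - v\<bar>)"
  assumes weight: "\<And>w h. (w, h) \<in> set xs \<Longrightarrow> 0 \<le> w" "(\<Sum>(w, h)\<leftarrow>xs. w) = 1"
    and path: "\<And>w h. (w, h) \<in> set xs \<Longrightarrow> continuous_on UNIV h"
      "\<And>w h t. (w, h) \<in> set xs \<Longrightarrow> t \<in> {0..1} \<Longrightarrow> h t \<in> {0..1} \<times> {0..1}"
    and margin: "\<And>u. u \<in> {0..1} \<Longrightarrow>
      (\<Sum>(w, h)\<leftarrow>xs. w * (measure unif {t. fst (h t) \<le> u} + measure unif {t. snd (h t) \<le> u})) = 2 * u"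
    and f: "continuous_on UNIV f"
    and dual: "\<And>u v. u \<in> {0..1} \<Longrightarrow> v \<in> {0..1} \<Longrightarrow> f u + f v \<le> k u v"
    and slack: "\<And>w h t. (w, h) \<in> set xs \<Longrightarrow> t \<in> {0..1} \<Longrightarrow>
      f (fst (h t)) + f (snd (h t)) = k (fst (h t)) (snd (h t))"
  obtains M where "coupling M"
    "mean_gap M = (\<Sum>(w, h)\<leftarrow>xs. w * (\<integral>t. \<bar>fst (h t) - snd (h t)\<bar> \<partial>unif))"
    "mean_sq_gap M = (\<Sum>(w, h)\<leftarrow>xs. w * (\<integral>t. (fst (h t) - snd (h t))\<^sup>2 \<partial>unif))"
    "\<And>M'. coupling M' \<Longrightarrow>
      \<sigma> * (mean_sq_gap M - 2 * c * mean_gap M) \<le> \<sigma> * (mean_sq_gap M' - 2 * c * mean_gap M')"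
proof -
  obtain M where M: "coupling M" and
    int: "\<And>\<phi> B. \<phi> \<in> borel_measurable borel \<Longrightarrow>
       (\<And>u v. u \<in> {0..1} \<Longrightarrow> v \<in> {0..1} \<Longrightarrow> \<bar>\<phi> (u, v)\<bar> \<le> B) \<Longrightarrow> (\<And>u v. \<phi> (u, v) = \<phi> (v, u)) \<Longrightarrow>
       (\<integral>\<omega>. \<phi> \<omega> \<partial>M) = (\<Sum>(w, h)\<leftarrow>xs. w * (\<integral>t. (\<phi> (h t) :: real) \<partial>unif))"
  proof (rule path_coupling[of xs])
    show "0 \<le> w" if "(w, h) \<in> set xs" for w h using that by (rule weight)
    show "continuous_on UNIV h" if "(w, h) \<in> set xs" for w h using that by (rule path)
    show "h t \<in> {0..1} \<times> {0..1}" if "(w, h) \<in> set xs" "t \<in> {0..1}" for w h t using that by (rule path)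
  qed (use weight(2) margin in blast)+
  have "bounded (f ` {0..1})"
    by (intro compact_imp_bounded compact_continuous_image continuous_on_subset[OF f]) auto
  then obtain B where "\<forall>t\<in>{0..1}. \<bar>f t\<bar> \<le> B"
    unfolding bounded_iff by auto
  then have B: "\<bar>f t\<bar> \<le> B" if "t \<in> {0..1}" for t using that by blast
  have fb: "f \<in> borel_measurable borel" using f by (rule borel_measurable_continuous_onI)
  have pot: "(\<lambda>\<omega>. f (fst \<omega>)) \<in> borel_measurable (borel :: (real \<times> real) measure)"
     "(\<lambda>\<omega>. f (snd \<omega>)) \<in> borel_measurable (borel :: (real \<times> real) measure)"
    by (intro borel_measurable_continuous_onI continuous_on_compose2[OF f] continuous_intros; simp)+
  have kb: "(\<lambda>\<omega>. k (fst \<omega>) (snd \<omega>)) \<in> borel_measurable (borel :: (real \<times> real) measure)"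
    unfolding k_def by (intro borel_measurable_continuous_onI continuous_intros)
  have k_int: "(\<integral>\<omega>. k (fst \<omega>) (snd \<omega>) \<partial>M') = \<sigma> * (mean_sq_gap M' - 2 * c * mean_gap M')"
    if M': "coupling M'" for M'
  proof -
    have "integrable M' (\<lambda>\<omega>. \<bar>fst \<omega> - snd \<omega>\<bar>)" "integrable M' (\<lambda>\<omega>. (fst \<omega> - snd \<omega>)\<^sup>2)"
      by (rule coupling_integrable[OF M' gap_measurable(1), of 1], use gap_bounded in auto)
         (rule coupling_integrable[OF M' gap_measurable(2), of 1], use gap_bounded in auto)
    then show ?thesis by (simp add: k_def mean_gap_def mean_sq_gap_def)
  qed
  have f_int: "integrable M' (\<lambda>\<omega>. f (fst \<omega>) + f (snd \<omega>))"
    "(\<integral>\<omega>. f (fst \<omega>) + f (snd \<omega>) \<partial>M') = 2 * (\<integral>t. f t \<partial>unif)"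
    if M': "coupling M'" for M'
  proof -
    have i: "integrable M' (\<lambda>\<omega>. f (fst \<omega>))" "integrable M' (\<lambda>\<omega>. f (snd \<omega>))"
      by (rule coupling_integrable[OF M' pot(1), of B], use B in auto)
         (rule coupling_integrable[OF M' pot(2), of B], use B in auto)
    then show "integrable M' (\<lambda>\<omega>. f (fst \<omega>) + f (snd \<omega>))" by simp
    show "(\<integral>\<omega>. f (fst \<omega>) + f (snd \<omega>) \<partial>M') = 2 * (\<integral>t. f t \<partial>unif)"
      using i by (simp add: coupling_margin[OF M' fb])
  qed
  have k_bound: "\<bar>k u v\<bar> \<le> \<bar>\<sigma>\<bar> * (1 + 2 * \<bar>c\<bar>)" if "u \<in> {0..1}" "v \<in> {0..1}" for u v
  proof -
    have "\<bar>\<bar>u - v\<bar>\<^sup>2 - 2 * c * \<bar>u - v\<bar>\<bar> \<le> \<bar>(u - v)\<^sup>2\<bar> + \<bar>2 * c * \<bar>u - v\<bar>\<bar>"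
      using abs_triangle_ineq4[of "(u - v)\<^sup>2" "2 * c * \<bar>u - v\<bar>"] by simp
    also have "\<dots> \<le> 1 + 2 * \<bar>c\<bar> * 1"
      using gap_bounded[OF that] by (intro add_mono) (auto simp: abs_mult intro!: mult_left_le)
    finally show ?thesis by (simp add: k_def abs_mult mult_left_mono)
  qed
  have "(\<integral>\<omega>. k (fst \<omega>) (snd \<omega>) \<partial>M) = (\<Sum>(w, h)\<leftarrow>xs. w * (\<integral>t. k (fst (h t)) (snd (h t)) \<partial>unif))"
    using k_bound by (intro int[OF kb]) (auto simp: k_def abs_minus_commute power2_commute)
  also have "\<dots> = (\<Sum>(w, h)\<leftarrow>xs. w * (\<integral>t. f (fst (h t)) + f (snd (h t)) \<partial>unif))"
  proof (intro arg_cong[where f=sum_list] map_cong refl, clarify)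
    fix w h assume wh: "(w, h) \<in> set xs"
    have h: "continuous_on UNIV (\<lambda>t. fst (h t))" "continuous_on UNIV (\<lambda>t. snd (h t))"
      using path(1)[OF wh] by (auto intro: continuous_intros)
    have "(\<integral>t. k (fst (h t)) (snd (h t)) \<partial>unif) = (\<integral>t. f (fst (h t)) + f (snd (h t)) \<partial>unif)"
    proof (rule integral_cong_AE)
      show "AE t in unif. k (fst (h t)) (snd (h t)) = f (fst (h t)) + f (snd (h t))"
        using AE_unif by eventually_elim (use slack[OF wh] in auto)
      have "(\<lambda>t. k (fst (h t)) (snd (h t))) \<in> borel_measurable borel"
        unfolding k_def by (intro borel_measurable_continuous_onI continuous_intros h)
      then show "(\<lambda>t. k (fst (h t)) (snd (h t))) \<in> borel_measurable unif"
        by (simp cong: measurable_cong_sets)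
      have "(\<lambda>t. f (fst (h t)) + f (snd (h t))) \<in> borel_measurable borel"
        by (intro borel_measurable_continuous_onI continuous_intros
            continuous_on_compose2[OF f h(1)] continuous_on_compose2[OF f h(2)]) auto
      then show "(\<lambda>t. f (fst (h t)) + f (snd (h t))) \<in> borel_measurable unif"
        by (simp cong: measurable_cong_sets)
    qed
    then show "w * (\<integral>t. k (fst (h t)) (snd (h t)) \<partial>unif) = w * (\<integral>t. f (fst (h t)) + f (snd (h t)) \<partial>unif)"
      by simp
  qed
  also have "\<dots> = (\<integral>\<omega>. f (fst \<omega>) + f (snd \<omega>) \<partial>M)"
  proof (rule int[symmetric, where B="B + B"])
    show "(\<lambda>\<omega>. f (fst \<omega>) + f (snd \<omega>)) \<in> borel_measurable (borel :: (real \<times> real) measure)"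
      using pot by (rule borel_measurable_add)
    show "\<bar>f (fst (u, v)) + f (snd (u, v))\<bar> \<le> B + B" if "u \<in> {0..1}" "v \<in> {0..1}" for u v
      using B[OF that(1)] B[OF that(2)] by simp
  qed simp
  also have "\<dots> = 2 * (\<integral>t. f t \<partial>unif)" by (rule f_int(2)[OF M])
  finally have optimum: "\<sigma> * (mean_sq_gap M - 2 * c * mean_gap M) = 2 * (\<integral>t. f t \<partial>unif)"
    by (simp add: k_int[OF M])
  have "\<sigma> * (mean_sq_gap M - 2 * c * mean_gap M) \<le> \<sigma> * (mean_sq_gap M' - 2 * c * mean_gap M')"
    if M': "coupling M'" for M'
  proof -
    have "(\<integral>\<omega>. f (fst \<omega>) + f (snd \<omega>) \<partial>M') \<le> (\<integral>\<omega>. k (fst \<omega>) (snd \<omega>) \<partial>M')"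
    proof (rule integral_mono_AE)
      show "integrable M' (\<lambda>\<omega>. k (fst \<omega>) (snd \<omega>))"
        by (rule coupling_integrable[OF M' kb]) (use k_bound in auto)
      show "AE \<omega> in M'. f (fst \<omega>) + f (snd \<omega>) \<le> k (fst \<omega>) (snd \<omega>)"
        using coupling_AE[OF M'] by eventually_elim (use dual in auto)
    qed (rule f_int(1)[OF M'])
    then show ?thesis by (simp add: k_int[OF M'] f_int(2)[OF M'] optimum)
  qed
  moreover have "mean_gap M = (\<Sum>(w, h)\<leftarrow>xs. w * (\<integral>t. \<bar>fst (h t) - snd (h t)\<bar> \<partial>unif))"
    unfolding mean_gap_def
    by (rule int[OF gap_measurable(1), of 1]) (use gap_bounded in \<open>auto simp: abs_minus_commute\<close>)
  moreover have "mean_sq_gap M = (\<Sum>(w, h)\<leftarrow>xs. w * (\<integral>t. (fst (h t) - snd (h t))\<^sup>2 \<partial>unif))"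
    unfolding mean_sq_gap_def
    by (rule int[OF gap_measurable(2), of 1]) (use gap_bounded in \<open>auto simp: power2_commute\<close>)
  ultimately show ?thesis using that M by blast
qed

definition segment :: "real \<Rightarrow> real \<Rightarrow> real \<Rightarrow> real \<Rightarrow> real \<Rightarrow> real \<times> real" where
  "segment p r q s = (\<lambda>t. (p + r * t, q + s * t))"

lemma segment_simps [simp]:
  "fst (segment p r q s t) = p + r * t" "snd (segment p r q s t) = q + s * t"
  by (simp_all add: segment_def)

lemma continuous_segment: "continuous_on UNIV (segment p r q s)"
  unfolding segment_def by (intro continuous_intros)

lemma affine_in_interval:
  fixes p r t :: real
  assumes "t \<in> {0..1}" "p \<in> {a..b}" "p + r \<in> {a..b}"
  shows "p + r * t \<in> {a..b}"
proof -
  have eq: "p + r * t = (1 - t) * p + t * (p + r)" by (simp add: algebra_simps)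
  have "(1 - t) * a + t * a \<le> (1 - t) * p + t * (p + r)"
    using assms by (intro add_mono mult_left_mono) auto
  moreover have "(1 - t) * p + t * (p + r) \<le> (1 - t) * b + t * b"
    using assms by (intro add_mono mult_left_mono) auto
  ultimately show ?thesis unfolding eq by (simp add: algebra_simps)
qed

lemma segment_in_square:
  assumes "t \<in> {0..1}" "p \<in> {0..1}" "p + r \<in> {0..1}" "q \<in> {0..1}" "q + s \<in> {0..1}"
  shows "segment p r q s t \<in> {0..1} \<times> {0..1}"
  using affine_in_interval[OF assms(1-3)] affine_in_interval[OF assms(1,4,5)]
  by (simp add: mem_Times_iff)

text \<open>The sign \<open>\<epsilon>\<close> of the gap must be constant along the segment; by linearity this is checked at the ends.\<close>
lemma segment_moments:
  assumes "\<bar>\<epsilon>\<bar> = 1" "0 \<le> \<epsilon> * (p - q)" "0 \<le> \<epsilon> * (p + r - (q + s))"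
  shows "(\<integral>t. \<bar>p + r * t - (q + s * t)\<bar> \<partial>unif) = \<epsilon> * (p - q + (r - s) / 2)"
    "(\<integral>t. (p + r * t - (q + s * t))\<^sup>2 \<partial>unif) = (p - q)\<^sup>2 + (p - q) * (r - s) + (r - s)\<^sup>2 / 3"
proof -
  have "(\<integral>t. \<bar>p + r * t - (q + s * t)\<bar> \<partial>unif) = (\<integral>t. \<epsilon> * (p - q) + \<epsilon> * (r - s) * t + 0 * t\<^sup>2 \<partial>unif)"
  proof (rule integral_cong_AE)
    show "AE t in unif. \<bar>p + r * t - (q + s * t)\<bar> = \<epsilon> * (p - q) + \<epsilon> * (r - s) * t + 0 * t\<^sup>2"
      using AE_unif
    proof eventually_elim
      case (elim t)
      have "\<epsilon> * (p - q) + \<epsilon> * (r - s) * t \<in> {0..max (\<epsilon> * (p - q)) (\<epsilon> * (p + r - (q + s)))}"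
        using elim assms(2,3) by (intro affine_in_interval[of t]) (auto simp: algebra_simps)
      then show ?case using assms(1) by (auto simp: abs_if algebra_simps split: if_splits)
    qed
  qed (auto simp: measurable_cong_sets[OF sets_unif refl])
  then show "(\<integral>t. \<bar>p + r * t - (q + s * t)\<bar> \<partial>unif) = \<epsilon> * (p - q + (r - s) / 2)"
    by (simp only: integral_unif_quadratic) (simp add: algebra_simps)
  have "(\<lambda>t. (p + r * t - (q + s * t))\<^sup>2) =
      (\<lambda>t. (p - q)\<^sup>2 + (2 * (p - q) * (r - s)) * t + (r - s)\<^sup>2 * t\<^sup>2)"
    by (rule ext) (simp add: power2_eq_square algebra_simps)
  then show "(\<integral>t. (p + r * t - (q + s * t))\<^sup>2 \<partial>unif) = (p - q)\<^sup>2 + (p - q) * (r - s) + (r - s)\<^sup>2 / 3"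
    by (simp only: integral_unif_quadratic)
qed

section \<open>The largest mean square gap\<close>

text \<open>The cost \<open>d(d - 2a)\<close> is negative for \<open>d \<le> 2a\<close> and increasing afterwards, so that \<open>d\<close> may be replaced by its bound
\<open>p + q\<close>, the sum of the distances to the centre; then \<open>(p + q)\<^sup>2 \<le> 2p\<^sup>2 + 2q\<^sup>2\<close> separates the variables. Both
steps are tight for reflected points, where \<open>p = q\<close>.\<close>
lemma max_dual_bound:
  fixes a u v :: real
  assumes a: "0 \<le> a"
  defines "f \<equiv> \<lambda>u. max 0 (2 * \<bar>u - 1/2\<bar> * (\<bar>u - 1/2\<bar> - a))"
  shows "\<bar>u - v\<bar>\<^sup>2 - 2 * a * \<bar>u - v\<bar> \<le> f u + f v"
proof -
  define p where "p = \<bar>u - 1/2\<bar>"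
  define q where "q = \<bar>v - 1/2\<bar>"
  define d where "d = \<bar>u - v\<bar>"
  have d: "0 \<le> d" "d \<le> p + q" by (auto simp: p_def q_def d_def)
  have "d * (d - 2 * a) \<le> f u + f v"
  proof (cases "d \<le> 2 * a")
    case True
    then have "d * (d - 2 * a) \<le> 0" using d by (simp add: mult_nonneg_nonpos)
    moreover have "0 \<le> f u" "0 \<le> f v" by (simp_all add: f_def)
    ultimately show ?thesis by linarith
  next
    case False
    then have "d * (d - 2 * a) \<le> (p + q) * (p + q - 2 * a)"
      using d by (intro mult_mono) auto
    also have "\<dots> = 2 * p * (p - a) + 2 * q * (q - a) - (p - q)\<^sup>2"
      by (simp add: power2_eq_square algebra_simps)
    also have "\<dots> \<le> 2 * p * (p - a) + 2 * q * (q - a)" by simp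
    also have "\<dots> \<le> f u + f v" by (auto simp: f_def p_def q_def intro: add_mono)
    finally show ?thesis .
  qed
  then show ?thesis by (simp add: d_def power2_eq_square algebra_simps)
qed

text \<open>The outer points are reflected in \<open>1/2\<close> and the inner ones stay fixed. The first path runs through
\<open>[0, 1/2 - a]\<close> only, because the symmetrization supplies the other outer interval.\<close>
lemma max_sq_gap:
  assumes a: "0 \<le> a" "a \<le> 1/2"
  obtains M where "coupling M" "mean_gap M = 1/2 - 2 * a\<^sup>2" "mean_sq_gap M = 1/3 - 8/3 * a ^ 3"
    "\<And>M'. coupling M' \<Longrightarrow> mean_gap M' = mean_gap M \<Longrightarrow> mean_sq_gap M' \<le> mean_sq_gap M"
proof -
  define h where "h = 1/2 - a"
  have h: "0 \<le> h" "h \<le> 1/2" "a = 1/2 - h" using a by (auto simp: h_def)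
  define f where "f = (\<lambda>u::real. max 0 (2 * \<bar>u - 1/2\<bar> * (\<bar>u - 1/2\<bar> - a)))"
  let ?xs = "[(2 * h, segment 0 h 1 (- h)), (2 * a, segment h (2 * a) h (2 * a))]"
  obtain M where M: "coupling M"
    "mean_gap M = (\<Sum>(w, h)\<leftarrow>?xs. w * (\<integral>t. \<bar>fst (h t) - snd (h t)\<bar> \<partial>unif))"
    "mean_sq_gap M = (\<Sum>(w, h)\<leftarrow>?xs. w * (\<integral>t. (fst (h t) - snd (h t))\<^sup>2 \<partial>unif))"
    and opt: "\<And>M'. coupling M' \<Longrightarrow>
      (-1) * (mean_sq_gap M - 2 * a * mean_gap M) \<le> (-1) * (mean_sq_gap M' - 2 * a * mean_gap M')"
  proof (rule gap_optimal[of ?xs "\<lambda>u. - f u" "-1" a])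
    show "0 \<le> w" if "(w, g) \<in> set ?xs" for w g using that a h by auto
    show "(\<Sum>(w, g)\<leftarrow>?xs. w) = 1" using h by simp
    show "continuous_on UNIV g" if "(w, g) \<in> set ?xs" for w g
      using that continuous_segment by auto
    show "g t \<in> {0..1} \<times> {0..1}" if "(w, g) \<in> set ?xs" "t \<in> {0..1}" for w g t
      using that h by (auto intro!: segment_in_square simp del: mem_Times_iff)
    show "(\<Sum>(w, g)\<leftarrow>?xs. w * (measure unif {t. fst (g t) \<le> u} + measure unif {t. snd (g t) \<le> u})) = 2 * u"
      if "u \<in> {0..1}" for u
    proof -
      have "(\<Sum>(w, g)\<leftarrow>?xs. w * (measure unif {t. fst (g t) \<le> u} + measure unif {t. snd (g t) \<le> u})) =
          2 * (h * measure unif {t. 0 + h * t \<le> u}) - 2 * ((- h) * measure unif {t. 1 + (- h) * t \<le> u})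
          + 2 * ((2 * a) * measure unif {t. h + 2 * a * t \<le> u})"
        by (simp add: algebra_simps)
      also have "\<dots> = 2 * u"
        unfolding measure_unif_affine using that h by auto
      finally show ?thesis .
    qed
    show "continuous_on UNIV (\<lambda>u. - f u)" unfolding f_def by (intro continuous_intros)
    show "- f u + - f v \<le> - 1 * (\<bar>u - v\<bar>\<^sup>2 - 2 * a * \<bar>u - v\<bar>)" for u v
      using max_dual_bound[OF a(1), of u v] by (simp add: f_def)
    show "- f (fst (g t)) + - f (snd (g t)) =
        - 1 * (\<bar>fst (g t) - snd (g t)\<bar>\<^sup>2 - 2 * a * \<bar>fst (g t) - snd (g t)\<bar>)"
      if "(w, g) \<in> set ?xs" "t \<in> {0..1}" for w g t
    proof -
      from that(1) consider "g = segment 0 h 1 (- h)" | "g = segment h (2 * a) h (2 * a)" by auto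
      then show ?thesis
      proof cases
        case 1
        have "h * t \<in> {0..h}" using affine_in_interval[of t 0 0 h h] that h by simp
        then have *: "\<bar>h * t - 1/2\<bar> = 1/2 - h * t" "\<bar>1 - h * t - 1/2\<bar> = 1/2 - h * t"
          "\<bar>h * t - (1 - h * t)\<bar> = 2 * (1/2 - h * t)" "1/2 - h * t \<ge> a" "1/2 - h * t \<ge> 0"
          using h by auto
        have "f (h * t) = 2 * (1/2 - h * t) * (1/2 - h * t - a)"
          "f (1 - h * t) = 2 * (1/2 - h * t) * (1/2 - h * t - a)"
          unfolding f_def * using *(4,5) by (simp_all add: max_def mult_nonneg_nonneg)
        moreover have "fst (g t) = h * t" "snd (g t) = 1 - h * t" using 1 by simp_all
        ultimately show ?thesis
          by (simp only: *(3)) (simp add: power2_eq_square algebra_simps)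
      next
        case 2
        have "h + 2 * a * t \<in> {1/2 - a..1/2 + a}"
          using that h a by (intro affine_in_interval[of t]) auto
        then have "\<bar>h + 2 * a * t - 1/2\<bar> \<le> a" by auto
        then have "2 * \<bar>h + 2 * a * t - 1/2\<bar> * (\<bar>h + 2 * a * t - 1/2\<bar> - a) \<le> 0"
          by (intro mult_nonneg_nonpos) auto
        then have "f (h + 2 * a * t) = 0" unfolding f_def by (rule max_absorb1)
        then show ?thesis unfolding 2 by simp
      qed
    qed
  qed blast
  have "mean_gap M = 1/2 - 2 * a\<^sup>2" "mean_sq_gap M = 1/3 - 8/3 * a ^ 3"
  proof -
    have seg: "(\<integral>t. \<bar>0 + h * t - (1 + - h * t)\<bar> \<partial>unif) = 1 - h"
      "(\<integral>t. (0 + h * t - (1 + - h * t))\<^sup>2 \<partial>unif) = 1 - 2 * h + 4 / 3 * h\<^sup>2"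
      using segment_moments[of "-1" 0 1 h "-h"] h by (simp_all add: power2_eq_square)
    have "mean_gap M = 2 * h * (1 - h)" "mean_sq_gap M = 2 * h * (1 - 2 * h + 4 / 3 * h\<^sup>2)"
      unfolding M(2,3) by (simp_all only: list.map sum_list.Cons sum_list.Nil case_prod_conv segment_simps seg) simp_all
    then show "mean_gap M = 1/2 - 2 * a\<^sup>2" "mean_sq_gap M = 1/3 - 8/3 * a ^ 3"
      unfolding h(3) by (simp_all add: power2_eq_square power3_eq_cube algebra_simps)
  qed
  moreover have "mean_sq_gap M' \<le> mean_sq_gap M" if "coupling M'" "mean_gap M' = mean_gap M" for M'
    using opt[OF that(1)] that(2) by simp
  ultimately show ?thesis using that[OF M(1)] by blast
qed


section \<open>Distance to a lattice\<close>

definition lattice_dist :: "real \<Rightarrow> real \<Rightarrow> real" where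
  "lattice_dist p x = \<bar>x - p * of_int (round (x / p))\<bar>"

lemma lattice_dist_le:
  assumes "0 < p"
  shows "lattice_dist p x \<le> \<bar>x - p * of_int k\<bar>"
proof -
  have "\<bar>x - p * of_int i\<bar> = p * \<bar>x / p - of_int i\<bar>" for i :: int
  proof -
    have "x - p * of_int i = p * (x / p - of_int i)" using assms by (simp add: field_simps)
    then show ?thesis using assms by (simp add: abs_mult)
  qed
  moreover have "\<bar>x / p - of_int (round (x / p))\<bar> \<le> \<bar>x / p - of_int k\<bar>"
    by (rule round_diff_minimal)
  ultimately show ?thesis using assms by (simp add: lattice_dist_def)
qed

lemma lattice_dist_lipschitz:
  assumes "0 < p"
  shows "\<bar>lattice_dist p x - lattice_dist p y\<bar> \<le> \<bar>x - y\<bar>"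
proof -
  have "lattice_dist p x \<le> lattice_dist p y + \<bar>x - y\<bar>" for x y
    using lattice_dist_le[OF assms, of x "round (y / p)"] unfolding lattice_dist_def[of p y] by linarith
  from this[of x y] this[of y x] show ?thesis by linarith
qed

lemma continuous_lattice_dist:
  assumes "0 < p"
  shows "continuous_on UNIV (lattice_dist p)"
proof (rule continuous_onI)
  fix x e :: real assume "0 < e"
  moreover have "dist (lattice_dist p y) (lattice_dist p x) \<le> dist y x" for y
    using lattice_dist_lipschitz[OF assms] by (simp add: dist_real_def)
  ultimately show "\<exists>d>0. \<forall>y\<in>UNIV. dist y x < d \<longrightarrow> dist (lattice_dist p y) (lattice_dist p x) \<le> e"
    by (meson less_imp_le order_trans)
qed

lemma lattice_dist_eq:
  assumes p: "0 < p" and y: "\<bar>y\<bar> \<le> p / 2"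
  shows "lattice_dist p (p * of_int k + y) = \<bar>y\<bar>"
proof (rule antisym)
  show "lattice_dist p (p * of_int k + y) \<le> \<bar>y\<bar>"
    using lattice_dist_le[OF p, of "p * of_int k + y" k] by simp
  define j where "j = round ((p * of_int k + y) / p)"
  have "\<bar>y\<bar> \<le> \<bar>p * of_int (k - j) + y\<bar>"
  proof (cases "k = j")
    case False
    then have "1 \<le> \<bar>k - j\<bar>" by linarith
    then have "1 \<le> \<bar>of_int (k - j) :: real\<bar>" by linarith
    then have "p * 1 \<le> p * \<bar>of_int (k - j)\<bar>" using p by (intro mult_left_mono) auto
    then have "p \<le> \<bar>p * of_int (k - j)\<bar>" using p by (simp add: abs_mult)
    then show ?thesis using y by linarith
  qed simp
  then show "\<bar>y\<bar> \<le> lattice_dist p (p * of_int k + y)"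
    by (simp add: lattice_dist_def j_def algebra_simps)
qed

lemma lattice_dist_cases:
  assumes "0 < p"
  obtains k :: int and y where "x = p * of_int k + y" "\<bar>y\<bar> \<le> p / 2" "lattice_dist p x = \<bar>y\<bar>"
proof -
  define k where "k = round (x / p)"
  define y where "y = x - p * of_int k"
  have "\<bar>of_int k - x / p\<bar> \<le> 1/2" unfolding k_def by (rule of_int_round_abs_le)
  then have "p * \<bar>of_int k - x / p\<bar> \<le> p * (1/2)" using assms by (intro mult_left_mono) auto
  moreover have "\<bar>y\<bar> = p * \<bar>of_int k - x / p\<bar>"
  proof -
    have "y = - (p * (of_int k - x / p))" using assms by (simp add: y_def field_simps)
    then show ?thesis using assms by (simp add: abs_mult)
  qed
  ultimately show ?thesis
    using that[of k y] by (simp add: y_def lattice_dist_def k_def)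
qed

text \<open>The translates by the half period \<open>c\<close> are the midpoints of the lattice, and the distances of a point to the
nearest lattice point and to the nearest midpoint add up to \<open>c\<close>.\<close>
lemma lattice_dist_shift:
  assumes c: "0 < c"
  shows "lattice_dist (2 * c) (x - c) = c - lattice_dist (2 * c) x"
proof -
  have p: "0 < 2 * c" using c by simp
  obtain k :: int and y where x: "x = 2 * c * of_int k + y" "\<bar>y\<bar> \<le> c" "lattice_dist (2 * c) x = \<bar>y\<bar>"
    using lattice_dist_cases[OF p, of x] by auto
  show ?thesis
  proof (cases "0 \<le> y")
    case True
    have "lattice_dist (2 * c) (2 * c * of_int k + (y - c)) = \<bar>y - c\<bar>"
      using x True by (intro lattice_dist_eq p) auto
    then show ?thesis using x True by (simp add: add_diff_eq)
  next
    case False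
    have "lattice_dist (2 * c) (2 * c * of_int (k - 1) + (y + c)) = \<bar>y + c\<bar>"
      using x False by (intro lattice_dist_eq p) auto
    moreover have "2 * c * of_int (k - 1) + (y + c) = x - c" by (simp add: x algebra_simps)
    ultimately have "lattice_dist (2 * c) (x - c) = \<bar>y + c\<bar>" by (simp only:)
    then show ?thesis using x(2,3) False by simp
  qed
qed

section \<open>The dual potential of the smallest mean square gap\<close>

text \<open>The minimization with multiplier \<open>2c\<close>. The number \<open>\<delta>\<close> is the largest displacement of the rearrangement modulo
\<open>2c\<close>, the assumption \<open>caps\<close> makes a peak cap and a trough cap fit into half a period, and \<open>fit\<close> places all
peak caps inside \<open>[0,1]\<close>.\<close>
locale staircase =
  fixes N :: nat and c \<delta> :: real
  assumes N: "1 \<le> N" and \<delta>: "0 \<le> \<delta>" and c: "0 < c"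
    and caps: "(2 * real N + 1) * \<delta> \<le> c"
    and fit: "real N * (c + \<delta>) \<le> 1/2"
begin

text \<open>One half period of the potential, as a function of the distance \<open>s \<in> [0,c]\<close> to the nearest peak. Its slope is
\<open>-2\<close> times the displacement, which is \<open>s/N\<close> on the peak cap, \<open>\<delta>\<close> between the caps and \<open>(c - s)/(N + 1)\<close> on the
trough cap. The two squares correct the straight line of slope \<open>-2\<delta>\<close> on the caps, and the constant makes
\<open>profile 0 + profile c = 0\<close>, since a peak is matched with a trough at distance exactly \<open>c\<close>.\<close>
definition profile :: "real \<Rightarrow> real" where
  "profile s = \<delta> * c - \<delta>\<^sup>2 / 2 - 2 * \<delta> * s - (max 0 (real N * \<delta> - s))\<^sup>2 / real N
     + (max 0 (s - (c - (real N + 1) * \<delta>)))\<^sup>2 / (real N + 1)"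

lemma N_pos: "0 < real N" using N by simp

text \<open>If \<open>\<alpha> \<ge> 0\<close>, the difference of the two sides is the square of \<open>(N + 1)\<alpha> - N\<tau>\<close> up to a positive factor, so equality
holds exactly along the linear map that stretches a peak cap to a trough cap.\<close>
lemma cap_bound:
  assumes "w = \<alpha> - \<tau>" "0 \<le> \<tau>"
  shows "\<tau>\<^sup>2 / (real N + 1) \<le> w\<^sup>2 + (max 0 \<alpha>)\<^sup>2 / real N"
proof (cases "0 \<le> \<alpha>")
  case True
  have "w\<^sup>2 + \<alpha>\<^sup>2 / real N - \<tau>\<^sup>2 / (real N + 1) = ((real N + 1) * \<alpha> - real N * \<tau>)\<^sup>2 / (real N * (real N + 1))"
    using N_pos by (simp add: assms(1) divide_simps) (simp add: power2_eq_square algebra_simps)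
  also have "\<dots> \<ge> 0" by simp
  finally show ?thesis using True by simp
next
  case False
  then have "\<tau> \<le> - w" using assms by simp
  then have "\<tau>\<^sup>2 \<le> w\<^sup>2" using assms(2) power_mono[of \<tau> "- w" 2] by simp
  moreover have "\<tau>\<^sup>2 / (real N + 1) \<le> \<tau>\<^sup>2" by (simp add: divide_simps mult_left_le algebra_simps)
  ultimately show ?thesis using False by simp
qed

text \<open>After completing the square in \<open>w = t - s - \<delta>\<close>, the claim compares the corrections by the caps: the two of the
trough caps, \<open>\<zeta>\<close> and \<open>\<tau>\<close>, must be dominated by \<open>w\<^sup>2\<close> and the two of the peak caps, \<open>\<alpha>\<close> and \<open>\<beta>\<close>. If only one trough
cap is active, \<open>cap_bound\<close> applies to the peak cap it is matched with. If both are, \<open>c \<ge> (2N + 1)\<delta>\<close> forces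
\<open>\<bar>w\<bar> \<ge> \<zeta> + \<tau>\<close>.\<close>
lemma profile_dual:
  "profile s + profile (c - t) \<le> (s - t)\<^sup>2"
proof -
  define w where "w = t - s - \<delta>"
  define \<alpha> where "\<alpha> = real N * \<delta> - s"
  define \<beta> where "\<beta> = real N * \<delta> - c + t"
  define \<zeta> where "\<zeta> = s - c + (real N + 1) * \<delta>"
  define \<tau> where "\<tau> = (real N + 1) * \<delta> - t"
  have w: "w = \<alpha> - \<tau>" "w = \<beta> - \<zeta>" "w = (2 * real N + 1) * \<delta> - c - (\<zeta> + \<tau>)"
    by (simp_all add: w_def \<alpha>_def \<beta>_def \<zeta>_def \<tau>_def algebra_simps)
  have pos: "0 \<le> (max 0 \<alpha>)\<^sup>2 / real N" "0 \<le> (max 0 \<beta>)\<^sup>2 / real N" by simp_all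
  have key: "(max 0 \<zeta>)\<^sup>2 / (real N + 1) + (max 0 \<tau>)\<^sup>2 / (real N + 1)
      \<le> w\<^sup>2 + (max 0 \<alpha>)\<^sup>2 / real N + (max 0 \<beta>)\<^sup>2 / real N"
  proof (cases "0 \<le> \<zeta> \<and> 0 \<le> \<tau>")
    case True
    then have "\<zeta> + \<tau> \<le> - w" using w(3) caps by simp
    then have "(\<zeta> + \<tau>)\<^sup>2 \<le> w\<^sup>2" using True power_mono[of "\<zeta> + \<tau>" "- w" 2] by simp
    moreover have "\<zeta>\<^sup>2 + \<tau>\<^sup>2 \<le> (\<zeta> + \<tau>)\<^sup>2" using True by (simp add: power2_sum)
    moreover have "(\<zeta>\<^sup>2 + \<tau>\<^sup>2) / (real N + 1) \<le> \<zeta>\<^sup>2 + \<tau>\<^sup>2"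
      by (simp add: divide_simps mult_left_le algebra_simps)
    ultimately have "\<zeta>\<^sup>2 / (real N + 1) + \<tau>\<^sup>2 / (real N + 1) \<le> w\<^sup>2"
      by (simp add: add_divide_distrib)
    moreover have "max 0 \<zeta> = \<zeta>" "max 0 \<tau> = \<tau>" using True by simp_all
    ultimately show ?thesis using pos by linarith
  next
    case False
    then consider "\<zeta> < 0" "\<tau> < 0" | "\<zeta> < 0" "0 \<le> \<tau>" | "0 \<le> \<zeta>" "\<tau> < 0" by linarith
    then show ?thesis
    proof cases
      case 1
      then show ?thesis using pos by simp
    next
      case 2
      then have "(max 0 \<zeta>)\<^sup>2 / (real N + 1) = 0" "max 0 \<tau> = \<tau>" by simp_all
      then show ?thesis using cap_bound[OF w(1) 2(2)] pos by linarith
    next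
      case 3
      then have "(max 0 \<tau>)\<^sup>2 / (real N + 1) = 0" "max 0 \<zeta> = \<zeta>" by simp_all
      then show ?thesis using cap_bound[OF w(2) 3(1)] pos by linarith
    qed
  qed
  have "profile s + profile (c - t) =
      (s - t)\<^sup>2 - w\<^sup>2 - (max 0 \<alpha>)\<^sup>2 / real N - (max 0 \<beta>)\<^sup>2 / real N
      + (max 0 \<zeta>)\<^sup>2 / (real N + 1) + (max 0 \<tau>)\<^sup>2 / (real N + 1)"
  proof -
    have "real N * \<delta> - (c - t) = \<beta>" "c - t - (c - (real N + 1) * \<delta>) = \<tau>"
      "s - (c - (real N + 1) * \<delta>) = \<zeta>" "real N * \<delta> - s = \<alpha>"
      by (simp_all add: \<alpha>_def \<beta>_def \<zeta>_def \<tau>_def)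
    then show ?thesis
      unfolding profile_def by (simp add: w_def power2_eq_square algebra_simps)
  qed
  with key show ?thesis by linarith
qed

text \<open>The profile is repeated evenly and \<open>2c\<close>-periodically, with peaks at \<open>1/2 - Nc + 2cj\<close>. Among these, the peaks with
\<open>0 \<le> j \<le> N\<close> lie symmetrically about \<open>1/2\<close>.\<close>
definition potential :: "real \<Rightarrow> real" where
  "potential u = profile (lattice_dist (2 * c) (u - 1/2 + real N * c))"

lemma continuous_potential: "continuous_on UNIV potential"
proof -
  have "continuous_on UNIV (\<lambda>u. lattice_dist (2 * c) (u - 1/2 + real N * c))"
    by (rule continuous_on_compose2[OF continuous_lattice_dist])
       (use c in \<open>auto intro!: continuous_intros\<close>)
  then show ?thesis
    unfolding potential_def profile_def using N_pos by (intro continuous_intros) auto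
qed

text \<open>The distance to the peaks is 1-Lipschitz, and a shift by \<open>c\<close> turns it into the distance to the troughs. Hence
\<open>\<bar>v - u - c\<bar>\<close> dominates the difference of the peak distance of \<open>u\<close> and the trough distance of \<open>v\<close>, which reduces
the claim on the line to the one on a half period.\<close>
lemma potential_dual: "potential u + potential v \<le> (\<bar>u - v\<bar> - c)\<^sup>2"
proof -
  have *: "potential u + potential v \<le> (v - u - c)\<^sup>2" for u v
  proof -
    let ?x = "u - 1/2 + real N * c" and ?y = "v - 1/2 + real N * c"
    define s where "s = lattice_dist (2 * c) ?x"
    define t where "t = lattice_dist (2 * c) (?y - c)"
    have "lattice_dist (2 * c) ?y = c - t"
      unfolding t_def using lattice_dist_shift[OF c, of ?y] by simp
    then have "potential u + potential v \<le> (s - t)\<^sup>2"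
      using profile_dual[of s t] by (simp add: potential_def s_def)
    also have "\<dots> \<le> (v - u - c)\<^sup>2"
    proof -
      have "\<bar>s - t\<bar> \<le> \<bar>?x - (?y - c)\<bar>"
        unfolding s_def t_def using c by (intro lattice_dist_lipschitz) simp
      then have "\<bar>s - t\<bar> \<le> \<bar>v - u - c\<bar>" by linarith
      then show ?thesis by (simp add: abs_le_square_iff)
    qed
    finally show ?thesis .
  qed
  show ?thesis using *[of u v] *[of v u] by (cases "u \<le> v") (auto simp: abs_if)
qed

definition peak :: "nat \<Rightarrow> real" where
  "peak j = 1/2 - real N * c + 2 * real j * c"

definition trough :: "nat \<Rightarrow> real" where
  "trough j = peak j + c"

lemma peak_Suc: "peak (Suc j) = peak j + 2 * c"
  by (simp add: peak_def algebra_simps)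

lemma potential_peak:
  assumes "\<bar>y\<bar> \<le> c"
  shows "potential (peak j + y) = profile \<bar>y\<bar>"
proof -
  have eq: "peak j + y - 1/2 + real N * c = 2 * c * of_int (int j) + y"
    by (simp add: peak_def algebra_simps)
  then show ?thesis
    unfolding potential_def eq using lattice_dist_eq[of "2 * c" y "int j"] c assms by simp
qed

lemma potential_trough:
  assumes "\<bar>y\<bar> \<le> c"
  shows "potential (trough j + y) = profile (c - \<bar>y\<bar>)"
proof -
  have eq: "trough j + y - 1/2 + real N * c = 2 * c * of_int (int (Suc j)) + y - c"
    by (simp add: peak_def trough_def algebra_simps)
  then show ?thesis
    unfolding potential_def eq lattice_dist_shift[OF c]
    using lattice_dist_eq[of "2 * c" y "int (Suc j)"] c assms by simp
qed

lemma cap_widths: "0 \<le> real N * \<delta>" "real N * \<delta> + (real N + 1) * \<delta> \<le> c"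
  using \<delta> caps by (auto simp: algebra_simps)

lemma profile_caps:
  assumes "0 \<le> \<omega>" "\<omega> \<le> 1"
  shows "profile (real N * \<delta> * \<omega>) + profile (c - (real N + 1) * \<delta> * \<omega>) = (\<delta> * \<omega>)\<^sup>2"
proof -
  have *: "real N * \<delta> * \<omega> \<le> real N * \<delta>" "(real N + 1) * \<delta> * \<omega> \<le> (real N + 1) * \<delta>"
    using assms \<delta> by (simp_all add: mult_left_le)
  have m: "max 0 (real N * \<delta> - real N * \<delta> * \<omega>) = real N * (\<delta> * (1 - \<omega>))"
    "max 0 (real N * \<delta> * \<omega> - (c - (real N + 1) * \<delta>)) = 0"
    "max 0 (real N * \<delta> - (c - (real N + 1) * \<delta> * \<omega>)) = 0"
    "max 0 (c - (real N + 1) * \<delta> * \<omega> - (c - (real N + 1) * \<delta>)) = (real N + 1) * (\<delta> * (1 - \<omega>))"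
    using * cap_widths by (auto simp: max_def algebra_simps)
  show ?thesis
    unfolding profile_def m using N_pos by (simp add: power_mult_distrib power2_eq_square) (simp add: algebra_simps)
qed

lemma profile_linear:
  assumes "real N * \<delta> \<le> s" "s \<le> c - (real N + 1) * \<delta>"
  shows "profile s = \<delta> * c - \<delta>\<^sup>2 / 2 - 2 * \<delta> * s"
  using assms by (simp add: profile_def max_def)

text \<open>Tightness on the caps: the points at relative position \<open>2t - 1 \<in> [-1,1]\<close> in a peak cap and in a trough cap are
matched, whichever caps these are.\<close>
lemma potential_cap:
  assumes "t \<in> {0..1}"
  shows "potential (peak i - real N * \<delta> + 2 * real N * \<delta> * t)
      + potential (trough j - (real N + 1) * \<delta> + 2 * (real N + 1) * \<delta> * t) = (\<delta> * (2 * t - 1))\<^sup>2"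
proof -
  define \<omega> where "\<omega> = \<bar>2 * t - 1\<bar>"
  have \<omega>: "0 \<le> \<omega>" "\<omega> \<le> 1" using assms by (auto simp: \<omega>_def abs_if)
  have *: "real N * \<delta> * \<omega> \<le> real N * \<delta>" "(real N + 1) * \<delta> * \<omega> \<le> (real N + 1) * \<delta>"
    using \<omega> \<delta> by (simp_all add: mult_left_le)
  have a: "\<bar>real N * \<delta> * (2 * t - 1)\<bar> = real N * \<delta> * \<omega>"
    "\<bar>(real N + 1) * \<delta> * (2 * t - 1)\<bar> = (real N + 1) * \<delta> * \<omega>"
    using \<delta> by (simp_all add: \<omega>_def abs_mult)
  have "0 \<le> (real N + 1) * \<delta>" using \<delta> by simp
  then have le: "real N * \<delta> * \<omega> \<le> c" "(real N + 1) * \<delta> * \<omega> \<le> c"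
    using * cap_widths by linarith+
  have "potential (peak i + real N * \<delta> * (2 * t - 1)) = profile (real N * \<delta> * \<omega>)"
    using le by (subst potential_peak) (simp_all only: a)
  moreover have "potential (trough j + (real N + 1) * \<delta> * (2 * t - 1)) = profile (c - (real N + 1) * \<delta> * \<omega>)"
    using le by (subst potential_trough) (simp_all only: a)
  ultimately have "potential (peak i + real N * \<delta> * (2 * t - 1))
      + potential (trough j + (real N + 1) * \<delta> * (2 * t - 1)) = (\<delta> * \<omega>)\<^sup>2"
    using profile_caps[OF \<omega>] by simp
  moreover have "(\<delta> * \<omega>)\<^sup>2 = (\<delta> * (2 * t - 1))\<^sup>2" by (simp add: \<omega>_def power_mult_distrib)
  moreover have "peak i - real N * \<delta> + 2 * real N * \<delta> * t = peak i + real N * \<delta> * (2 * t - 1)"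
    "trough j - (real N + 1) * \<delta> + 2 * (real N + 1) * \<delta> * t = trough j + (real N + 1) * \<delta> * (2 * t - 1)"
    by (simp_all add: algebra_simps)
  ultimately show ?thesis by (simp only:)
qed

lemma potential_spacer:
  assumes "real N * \<delta> \<le> y" "y \<le> c - (real N + 1) * \<delta>"
  shows "potential (peak j + y) = \<delta> * c - \<delta>\<^sup>2 / 2 - 2 * \<delta> * y"
    "potential (peak j - y) = \<delta> * c - \<delta>\<^sup>2 / 2 - 2 * \<delta> * y"
proof -
  have "0 \<le> (real N + 1) * \<delta>" using \<delta> by simp
  then have y: "0 \<le> y" "y \<le> c" using assms cap_widths by linarith+
  show "potential (peak j + y) = \<delta> * c - \<delta>\<^sup>2 / 2 - 2 * \<delta> * y"
    using potential_peak[of y j] y profile_linear[OF assms] by simp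
  show "potential (peak j - y) = \<delta> * c - \<delta>\<^sup>2 / 2 - 2 * \<delta> * y"
    using potential_peak[of "- y" j] y profile_linear[OF assms] by simp
qed

section \<open>Optimal couplings for the smallest mean square gap\<close>

text \<open>The length of the interval between a peak cap and the neighbouring trough cap.\<close>
definition spacer :: real where
  "spacer = c - (2 * real N + 1) * \<delta>"

lemma spacer_nonneg: "0 \<le> spacer"
  using caps by (simp add: spacer_def)

lemma sum_cap_weights:
  fixes F :: "nat \<Rightarrow> real"
  shows "(\<Sum>j<n. (real n - real j) * F j + (real j + 1) * F (Suc j)) = real n * (\<Sum>j\<le>n. F j)"
proof -
  have "(\<Sum>j<n. (real n - real j) * F j) = (\<Sum>j\<le>n. (real n - real j) * F j)"
    by (simp add: lessThan_Suc_atMost[symmetric])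
  moreover have "(\<Sum>j<n. (real j + 1) * F (Suc j)) = (\<Sum>j\<le>n. real j * F j)"
    by (simp add: lessThan_Suc_atMost[symmetric] sum.lessThan_Suc_shift add.commute del: sum.lessThan_Suc)
  ultimately have "(\<Sum>j<n. (real n - real j) * F j + (real j + 1) * F (Suc j)) =
      (\<Sum>j\<le>n. (real n - real j) * F j + real j * F j)"
    by (simp only: sum.distrib)
  also have "\<dots> = (\<Sum>j\<le>n. real n * F j)"
    by (intro sum.cong refl) (simp add: algebra_simps)
  finally show ?thesis by (simp only: sum_distrib_left)
qed

text \<open>A peak cap with index \<open>j\<close> sends the share \<open>(N - j)/N\<close> of its mass to the trough cap above it and \<open>j/N\<close> to the one
below. Each of the \<open>N + 1\<close> peak caps is then exhausted, and each of the \<open>N\<close> trough caps receives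
\<open>(N - j)/N + (j + 1)/N = (N + 1)/N\<close> times the mass of a peak cap, which is its own mass. The weights are
twice the masses because the symmetrization reflects half of every path.\<close>
definition cap_up :: "nat \<Rightarrow> real \<times> (real \<Rightarrow> real \<times> real)" where
  "cap_up j = (4 * \<delta> * (real N - real j), segment (peak j - real N * \<delta>) (2 * real N * \<delta>)
     (trough j - (real N + 1) * \<delta>) (2 * (real N + 1) * \<delta>))"

definition cap_down :: "nat \<Rightarrow> real \<times> (real \<Rightarrow> real \<times> real)" where
  "cap_down j = (4 * \<delta> * (real j + 1), segment (peak (Suc j) - real N * \<delta>) (2 * real N * \<delta>)
     (trough j - (real N + 1) * \<delta>) (2 * (real N + 1) * \<delta>))"

definition spacer_shift :: "(nat \<Rightarrow> real) \<Rightarrow> real \<Rightarrow> nat \<Rightarrow> real \<times> (real \<Rightarrow> real \<times> real)" where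
  "spacer_shift a l j = (2 * spacer, segment (a j) spacer (a j + l) spacer)"

definition incr :: "(real \<Rightarrow> real) \<Rightarrow> real \<Rightarrow> real \<Rightarrow> real" where
  "incr \<Phi> p r = \<Phi> (p + r) - \<Phi> p"

definition margin_weight :: "real \<Rightarrow> real \<times> (real \<Rightarrow> real \<times> real) \<Rightarrow> real" where
  "margin_weight u = (\<lambda>(w, h). w * (measure unif {t. fst (h t) \<le> u} + measure unif {t. snd (h t) \<le> u}))"

lemma unif_incr: "r * measure unif {t. p + r * t \<le> u} = incr (min u) p r"
  by (simp add: measure_unif_affine incr_def)

lemma peak_range:
  assumes "j \<le> N"
  shows "0 \<le> peak j - real N * \<delta>" "peak j + real N * \<delta> \<le> 1"
proof -
  have "2 * real j * c \<le> 2 * real N * c" using assms c by (intro mult_right_mono) auto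
  moreover have "0 \<le> 2 * real j * c" using c by simp
  ultimately show "0 \<le> peak j - real N * \<delta>" "peak j + real N * \<delta> \<le> 1"
    using fit unfolding peak_def distrib_left by linarith+
qed

lemma trough_range:
  assumes "j < N"
  shows "0 \<le> trough j - (real N + 1) * \<delta>" "trough j + (real N + 1) * \<delta> \<le> 1"
  using peak_range[of j] peak_range[of "Suc j"] assms cap_widths peak_Suc[of j]
  by (simp_all add: trough_def)

text \<open>The shares carried up and down add up to the uniform measure on all caps. The factor 2 stands for the two
margins, which the symmetrization averages.\<close>
lemma margin_caps:
  "(\<Sum>j<N. margin_weight u (cap_up j)) + (\<Sum>j<N. margin_weight u (cap_down j)) =
   2 * ((\<Sum>j\<le>N. incr (min u) (peak j - real N * \<delta>) (2 * real N * \<delta>))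
      + (\<Sum>j<N. incr (min u) (trough j - (real N + 1) * \<delta>) (2 * (real N + 1) * \<delta>)))"
proof -
  let ?P = "\<lambda>j. incr (min u) (peak j - real N * \<delta>) (2 * real N * \<delta>)"
  let ?V = "\<lambda>j. incr (min u) (trough j - (real N + 1) * \<delta>) (2 * (real N + 1) * \<delta>)"
  have scale: "k / n * (2 * n * \<delta> * x) = 2 * \<delta> * k * x" if "n \<noteq> 0" for k n x
    using that by simp
  have cap: "4 * \<delta> * k * (measure unif {t. p + 2 * real N * \<delta> * t \<le> u} + measure unif {t. q + 2 * (real N + 1) * \<delta> * t \<le> u})
      = 2 * (k / real N * incr (min u) p (2 * real N * \<delta>) + k / (real N + 1) * incr (min u) q (2 * (real N + 1) * \<delta>))"
    for k p q
    unfolding unif_incr[symmetric] using N_pos by (subst (1 2) scale) (auto simp: algebra_simps)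
  have up: "margin_weight u (cap_up j) =
      2 * ((real N - real j) / real N * ?P j + (real N - real j) / (real N + 1) * ?V j)" for j
    unfolding margin_weight_def cap_up_def case_prod_conv segment_simps by (rule cap)
  have down: "margin_weight u (cap_down j) =
      2 * ((real j + 1) / real N * ?P (Suc j) + (real j + 1) / (real N + 1) * ?V j)" for j
    unfolding margin_weight_def cap_down_def case_prod_conv segment_simps by (rule cap)
  have "(\<Sum>j<N. margin_weight u (cap_up j)) + (\<Sum>j<N. margin_weight u (cap_down j)) =
     (\<Sum>j<N. 2 / real N * ((real N - real j) * ?P j + (real j + 1) * ?P (Suc j)) + 2 * ?V j)"
    unfolding sum.distrib[symmetric]
  proof (rule sum.cong[OF refl])
    fix j
    have "(real N - real j) / (real N + 1) * v + (real j + 1) / (real N + 1) * v = v" for v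
    proof -
      have "(real N - real j) / (real N + 1) * v + (real j + 1) / (real N + 1) * v =
          ((real N - real j) + (real j + 1)) / (real N + 1) * v"
        by (simp only: add_divide_distrib distrib_right)
      then show ?thesis by simp
    qed
    moreover have "2 * (x / real N * p + x / (real N + 1) * v) + 2 * (y / real N * p' + y / (real N + 1) * v) =
        2 / real N * (x * p + y * p') + 2 * (x / (real N + 1) * v + y / (real N + 1) * v)" for x y p p' v :: real
      by (simp add: ring_distribs add_divide_distrib)
    ultimately show "margin_weight u (cap_up j) + margin_weight u (cap_down j) =
        2 / real N * ((real N - real j) * ?P j + (real j + 1) * ?P (Suc j)) + 2 * ?V j"
      unfolding up down by (simp only:)
  qed
  also have "\<dots> = 2 / real N * (real N * (\<Sum>j\<le>N. ?P j)) + 2 * (\<Sum>j<N. ?V j)"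
    using sum_cap_weights[of N ?P] by (simp only: sum.distrib sum_distrib_left[symmetric])
  finally show ?thesis using N_pos by simp
qed

text \<open>The part common to both sides of an endpoint \<open>l\<close>: cap paths as above, and spacers starting at \<open>a j\<close> that are
translated upwards by \<open>l\<close>. The assumption \<open>tiling\<close> says that the caps, these spacers and their images tile \<open>[0,1]\<close>;
increments of an arbitrary function express this by telescoping. On a cap path the gap \<open>\<bar>U - V\<bar>\<close> averages to
\<open>c\<close> with variance \<open>\<delta>\<^sup>2/3\<close>, and the cap paths have total mass \<open>4\<delta>N(N + 1)\<close>.\<close>
lemma staircase_optimal:
  fixes a :: "nat \<Rightarrow> real" and l :: real and js :: "nat list"
  assumes l: "0 \<le> l" "(l - c)\<^sup>2 = \<delta>\<^sup>2"
    and mass: "2 * spacer * real (length js) = 1 - 4 * \<delta> * real N * (real N + 1)"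
    and range: "\<And>j. j \<in> set js \<Longrightarrow> 0 \<le> a j \<and> a j + l + spacer \<le> 1"
    and slack: "\<And>j y. j \<in> set js \<Longrightarrow> 0 \<le> y \<Longrightarrow> y \<le> spacer \<Longrightarrow>
      potential (a j + y) + potential (a j + l + y) = \<delta>\<^sup>2"
    and tiling: "\<And>\<Phi> :: real \<Rightarrow> real. (\<Sum>j\<le>N. incr \<Phi> (peak j - real N * \<delta>) (2 * real N * \<delta>))
      + (\<Sum>j<N. incr \<Phi> (trough j - (real N + 1) * \<delta>) (2 * (real N + 1) * \<delta>))
      + (\<Sum>j\<leftarrow>js. incr \<Phi> (a j) spacer + incr \<Phi> (a j + l) spacer) = \<Phi> 1 - \<Phi> 0"
  obtains M where "coupling M"
    "mean_gap M = 4 * \<delta> * real N * (real N + 1) * c + (1 - 4 * \<delta> * real N * (real N + 1)) * l"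
    "mean_sq_gap M = 4 * \<delta> * real N * (real N + 1) * (c\<^sup>2 + \<delta>\<^sup>2 / 3)
       + (1 - 4 * \<delta> * real N * (real N + 1)) * l\<^sup>2"
    "\<And>M'. coupling M' \<Longrightarrow> mean_gap M' = mean_gap M \<Longrightarrow> mean_sq_gap M \<le> mean_sq_gap M'"
proof -
  define xs where "xs = map cap_up [0..<N] @ map cap_down [0..<N] @ map (spacer_shift a l) js"
  have xs_sum: "(\<Sum>x\<leftarrow>xs. F x) =
      (\<Sum>j<N. F (cap_up j)) + (\<Sum>j<N. F (cap_down j)) + (\<Sum>j\<leftarrow>js. F (spacer_shift a l j))"
    for F :: "_ \<Rightarrow> real"
    by (simp add: xs_def comp_def interv_sum_list_conv_sum_set_nat atLeast0LessThan)
  have xs_cases: "(\<exists>j<N. (w, h) = cap_up j) \<or> (\<exists>j<N. (w, h) = cap_down j) \<or> (\<exists>j\<in>set js. (w, h) = spacer_shift a l j)"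
    if "(w, h) \<in> set xs" for w h
    using that by (auto simp: xs_def)
  have weights: "(\<Sum>j<N. 4 * \<delta> * (real N - real j) * x) + (\<Sum>j<N. 4 * \<delta> * (real j + 1) * x) =
      4 * \<delta> * real N * (real N + 1) * x" for x
  proof -
    have "(\<Sum>j<N. 4 * \<delta> * (real N - real j) * x) + (\<Sum>j<N. 4 * \<delta> * (real j + 1) * x) =
        (\<Sum>j<N. 4 * \<delta> * (real N + 1) * x)"
      unfolding sum.distrib[symmetric] by (intro sum.cong refl) (simp add: algebra_simps)
    then show ?thesis by simp
  qed
  have "(real N + 1) * \<delta> = real N * \<delta> + \<delta>" by (simp add: algebra_simps)
  then have cd: "0 \<le> c - \<delta>" "0 \<le> c + \<delta>" using cap_widths \<delta> c by linarith+
  have up_moments: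
    "(\<integral>t. \<bar>peak j - real N * \<delta> + 2 * real N * \<delta> * t - (trough j - (real N + 1) * \<delta> + 2 * (real N + 1) * \<delta> * t)\<bar> \<partial>unif) = c"
    "(\<integral>t. (peak j - real N * \<delta> + 2 * real N * \<delta> * t - (trough j - (real N + 1) * \<delta> + 2 * (real N + 1) * \<delta> * t))\<^sup>2 \<partial>unif)
      = c\<^sup>2 + \<delta>\<^sup>2 / 3" for j
    using segment_moments[of "-1" "peak j - real N * \<delta>" "trough j - (real N + 1) * \<delta>" "2 * real N * \<delta>" "2 * (real N + 1) * \<delta>"] cd
    by (simp_all add: trough_def algebra_simps power2_eq_square)
  have down_moments:
    "(\<integral>t. \<bar>peak (Suc j) - real N * \<delta> + 2 * real N * \<delta> * t - (trough j - (real N + 1) * \<delta> + 2 * (real N + 1) * \<delta> * t)\<bar> \<partial>unif) = c"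
    "(\<integral>t. (peak (Suc j) - real N * \<delta> + 2 * real N * \<delta> * t - (trough j - (real N + 1) * \<delta> + 2 * (real N + 1) * \<delta> * t))\<^sup>2 \<partial>unif)
      = c\<^sup>2 + \<delta>\<^sup>2 / 3" for j
    using segment_moments[of "1" "peak (Suc j) - real N * \<delta>" "trough j - (real N + 1) * \<delta>" "2 * real N * \<delta>" "2 * (real N + 1) * \<delta>"] cd
    by (simp_all add: trough_def peak_Suc algebra_simps power2_eq_square)
  have spacer_moments: "(\<integral>t. \<bar>a j + spacer * t - (a j + l + spacer * t)\<bar> \<partial>unif) = l"
    "(\<integral>t. (a j + spacer * t - (a j + l + spacer * t))\<^sup>2 \<partial>unif) = l\<^sup>2" for j
    using segment_moments[of "-1" "a j" "a j + l" spacer spacer] l(1) by (simp_all add: power2_eq_square)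
  obtain M where M: "coupling M"
    "mean_gap M = (\<Sum>(w, h)\<leftarrow>xs. w * (\<integral>t. \<bar>fst (h t) - snd (h t)\<bar> \<partial>unif))"
    "mean_sq_gap M = (\<Sum>(w, h)\<leftarrow>xs. w * (\<integral>t. (fst (h t) - snd (h t))\<^sup>2 \<partial>unif))"
    and opt: "\<And>M'. coupling M' \<Longrightarrow>
      1 * (mean_sq_gap M - 2 * c * mean_gap M) \<le> 1 * (mean_sq_gap M' - 2 * c * mean_gap M')"
  \<comment> \<open>As \<open>(d - c)\<^sup>2 = d\<^sup>2 - 2cd + c\<^sup>2\<close>, half of \<open>c\<^sup>2\<close> is taken off each potential.\<close>
  proof (rule gap_optimal[of xs "\<lambda>u. potential u - c\<^sup>2 / 2" 1 c])
    show "0 \<le> w" if "(w, h) \<in> set xs" for w h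
      using xs_cases[OF that] \<delta> spacer_nonneg by (auto simp: cap_up_def cap_down_def spacer_shift_def)
    show "(\<Sum>(w, h)\<leftarrow>xs. w) = 1"
      using weights[of 1] mass by (simp add: xs_sum cap_up_def cap_down_def spacer_shift_def sum_list_triv mult.commute[of "real (length js)"])
    show "continuous_on UNIV h" if "(w, h) \<in> set xs" for w h
      using xs_cases[OF that] by (auto simp: cap_up_def cap_down_def spacer_shift_def continuous_segment)
    show "h t \<in> {0..1} \<times> {0..1}" if wh: "(w, h) \<in> set xs" and t: "t \<in> {0..1}" for w h t
    proof -
      have pos: "0 \<le> real N * \<delta>" "0 \<le> (real N + 1) * \<delta>" using \<delta> by auto
      have ends: "peak i - real N * \<delta> + 2 * real N * \<delta> = peak i + real N * \<delta>"
        "trough i - (real N + 1) * \<delta> + 2 * (real N + 1) * \<delta> = trough i + (real N + 1) * \<delta>" for i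
        by (simp_all add: algebra_simps)
      have cap: "segment (peak i - real N * \<delta>) (2 * real N * \<delta>)
          (trough j - (real N + 1) * \<delta>) (2 * (real N + 1) * \<delta>) t \<in> {0..1} \<times> {0..1}" if "i \<le> N" "j < N" for i j
        by (rule segment_in_square[OF t], simp_all only: ends)
           (use peak_range[OF that(1)] trough_range[OF that(2)] pos in auto)
      have "segment (a j) spacer (a j + l) spacer t \<in> {0..1} \<times> {0..1}" if "j \<in> set js" for j
        by (rule segment_in_square[OF t]) (use range[OF that] l(1) spacer_nonneg in auto)
      then show ?thesis
        using xs_cases[OF wh] cap
        by (auto simp: cap_up_def cap_down_def spacer_shift_def simp del: mem_Times_iff)
    qed
    show "(\<Sum>(w, h)\<leftarrow>xs. w * (measure unif {t. fst (h t) \<le> u} + measure unif {t. snd (h t) \<le> u})) = 2 * u"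
      if u: "u \<in> {0..1}" for u
    proof -
      have g: "margin_weight u (spacer_shift a l j) = 2 * (incr (min u) (a j) spacer + incr (min u) (a j + l) spacer)" for j
        unfolding margin_weight_def spacer_shift_def case_prod_conv segment_simps unif_incr[symmetric]
        by (simp add: algebra_simps)
      have "(\<Sum>x\<leftarrow>xs. margin_weight u x) = 2 * (min u 1 - min u 0)"
        unfolding xs_sum margin_caps tiling[symmetric] g sum_list_const_mult by (simp add: algebra_simps)
      then show ?thesis using u by (simp add: margin_weight_def)
    qed
    show "continuous_on UNIV (\<lambda>u. potential u - c\<^sup>2 / 2)"
      using continuous_potential by (intro continuous_intros)
    show "potential u - c\<^sup>2 / 2 + (potential v - c\<^sup>2 / 2) \<le> 1 * (\<bar>u - v\<bar>\<^sup>2 - 2 * c * \<bar>u - v\<bar>)" for u v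
      using potential_dual[of u v] by (simp add: power2_diff algebra_simps)
    show "potential (fst (h t)) - c\<^sup>2 / 2 + (potential (snd (h t)) - c\<^sup>2 / 2) =
        1 * (\<bar>fst (h t) - snd (h t)\<bar>\<^sup>2 - 2 * c * \<bar>fst (h t) - snd (h t)\<bar>)"
      if wh: "(w, h) \<in> set xs" and t: "t \<in> {0..1}" for w h t
    proof -
      have d: "\<delta> * t \<in> {0..\<delta>}" using affine_in_interval[of t 0 0 \<delta> \<delta>] t \<delta> by simp
      have "potential (fst (h t)) + potential (snd (h t)) = (\<bar>fst (h t) - snd (h t)\<bar> - c)\<^sup>2"
        using xs_cases[OF wh]
      proof (elim disjE exE bexE conjE)
        fix j assume j: "j < N" "(w, h) = cap_up j"
        then have h: "fst (h t) = peak j - real N * \<delta> + 2 * real N * \<delta> * t"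
          "snd (h t) = trough j - (real N + 1) * \<delta> + 2 * (real N + 1) * \<delta> * t"
          by (simp_all add: cap_up_def)
        have "snd (h t) - fst (h t) = c - \<delta> + 2 * (\<delta> * t)"
          unfolding h by (simp add: trough_def algebra_simps)
        then have "\<bar>fst (h t) - snd (h t)\<bar> - c = \<delta> * (2 * t - 1)"
          using cd d by (simp add: algebra_simps)
        then show ?thesis unfolding h using potential_cap[OF t] by simp
      next
        fix j assume j: "j < N" "(w, h) = cap_down j"
        then have h: "fst (h t) = peak (Suc j) - real N * \<delta> + 2 * real N * \<delta> * t"
          "snd (h t) = trough j - (real N + 1) * \<delta> + 2 * (real N + 1) * \<delta> * t"
          by (simp_all add: cap_down_def)
        have "fst (h t) - snd (h t) = c + \<delta> - 2 * (\<delta> * t)"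
          unfolding h by (simp add: trough_def peak_Suc algebra_simps)
        then have "\<bar>fst (h t) - snd (h t)\<bar> - c = - (\<delta> * (2 * t - 1))"
          using cd d by (simp add: algebra_simps)
        then show ?thesis unfolding h using potential_cap[OF t] by simp
      next
        fix j assume j: "j \<in> set js" "(w, h) = spacer_shift a l j"
        then have h: "fst (h t) = a j + spacer * t" "snd (h t) = a j + l + spacer * t"
          by (simp_all add: spacer_shift_def)
        have "spacer * t \<in> {0..spacer}" using affine_in_interval[of t 0 0 spacer spacer] t spacer_nonneg by simp
        then show ?thesis unfolding h using slack[OF j(1)] l by simp
      qed
      then show ?thesis by (simp add: power2_diff algebra_simps)
    qed
  qed blast
  have mean: "mean_gap M = 4 * \<delta> * real N * (real N + 1) * c + (1 - 4 * \<delta> * real N * (real N + 1)) * l"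
    unfolding M(2) xs_sum cap_up_def cap_down_def spacer_shift_def case_prod_conv segment_simps
      up_moments down_moments spacer_moments weights sum_list_triv mass[symmetric] by simp
  have sq: "mean_sq_gap M = 4 * \<delta> * real N * (real N + 1) * (c\<^sup>2 + \<delta>\<^sup>2 / 3)
       + (1 - 4 * \<delta> * real N * (real N + 1)) * l\<^sup>2"
    unfolding M(3) xs_sum cap_up_def cap_down_def spacer_shift_def case_prod_conv segment_simps
      up_moments down_moments spacer_moments weights sum_list_triv mass[symmetric] by simp
  have "mean_sq_gap M \<le> mean_sq_gap M'" if "coupling M'" "mean_gap M' = mean_gap M" for M'
    using opt[OF that(1)] that(2) by simp
  then show ?thesis using that[OF M(1) mean sq] by blast
qed


lemma cap_spacer_ends:
  "peak j - real N * \<delta> + 2 * real N * \<delta> = peak j + real N * \<delta>"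
  "peak j + real N * \<delta> + spacer = trough j - (real N + 1) * \<delta>"
  "trough j - (real N + 1) * \<delta> + 2 * (real N + 1) * \<delta> = trough j + (real N + 1) * \<delta>"
  "trough j + (real N + 1) * \<delta> + spacer = peak (Suc j) - real N * \<delta>"
  by (simp_all add: trough_def peak_Suc spacer_def algebra_simps)

text \<open>Mean gaps below \<open>l = 1/(2N)\<close>. The unit interval begins and ends with a peak cap, and the spacer after the
\<open>j\<close>-th peak cap is translated onto the spacer before the next one.\<close>
lemma optimal_below:
  assumes l: "2 * real N * (c + \<delta>) = 1"
  obtains M where "coupling M"
    "mean_gap M = c + \<delta> - 4 * real N * (real N + 1) * \<delta>\<^sup>2"
    "mean_sq_gap M = (c + \<delta>)\<^sup>2 - 2 * (c + \<delta>) * (4 * real N * (real N + 1) * \<delta>\<^sup>2)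
       + 4 / 3 * (4 * real N * (real N + 1) * \<delta>\<^sup>2) * \<delta>"
    "\<And>M'. coupling M' \<Longrightarrow> mean_gap M' = mean_gap M \<Longrightarrow> mean_sq_gap M \<le> mean_sq_gap M'"
proof -
  let ?a = "\<lambda>j. peak j + real N * \<delta>"
  have partner: "?a j + (c + \<delta>) = trough j + (real N + 1) * \<delta>" for j
    by (simp add: trough_def algebra_simps)
  obtain M where M: "coupling M"
    "mean_gap M = 4 * \<delta> * real N * (real N + 1) * c + (1 - 4 * \<delta> * real N * (real N + 1)) * (c + \<delta>)"
    "mean_sq_gap M = 4 * \<delta> * real N * (real N + 1) * (c\<^sup>2 + \<delta>\<^sup>2 / 3)
       + (1 - 4 * \<delta> * real N * (real N + 1)) * (c + \<delta>)\<^sup>2"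
    "\<And>M'. coupling M' \<Longrightarrow> mean_gap M' = mean_gap M \<Longrightarrow> mean_sq_gap M \<le> mean_sq_gap M'"
  proof (rule staircase_optimal[of "c + \<delta>" "[0..<N]" ?a])
    show "0 \<le> c + \<delta>" using c \<delta> by simp
    show "(c + \<delta> - c)\<^sup>2 = \<delta>\<^sup>2" by simp
    have "2 * spacer * real N = 2 * real N * (c + \<delta>) - 4 * \<delta> * real N * (real N + 1)"
      by (simp add: spacer_def algebra_simps)
    then show "2 * spacer * real (length [0..<N]) = 1 - 4 * \<delta> * real N * (real N + 1)"
      by (simp add: l)
    show "0 \<le> ?a j \<and> ?a j + (c + \<delta>) + spacer \<le> 1" if "j \<in> set [0..<N]" for j
    proof -
      have "j \<le> N" "Suc j \<le> N" using that by auto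
      then show ?thesis
        using peak_range[of j] peak_range[of "Suc j"] cap_widths(1)
        unfolding partner cap_spacer_ends by linarith
    qed
    show "potential (?a j + y) + potential (?a j + (c + \<delta>) + y) = \<delta>\<^sup>2"
      if "j \<in> set [0..<N]" "0 \<le> y" "y \<le> spacer" for j y
    proof -
      have y: "real N * \<delta> \<le> real N * \<delta> + y" "real N * \<delta> + y \<le> c - (real N + 1) * \<delta>"
        using that by (auto simp: spacer_def algebra_simps)
      have y': "real N * \<delta> \<le> c - (real N + 1) * \<delta> - y" "c - (real N + 1) * \<delta> - y \<le> c - (real N + 1) * \<delta>"
        using that by (auto simp: spacer_def algebra_simps)
      have e: "?a j + y = peak j + (real N * \<delta> + y)"
        "?a j + (c + \<delta>) + y = peak (Suc j) - (c - (real N + 1) * \<delta> - y)"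
        by (simp_all add: peak_Suc algebra_simps)
      show ?thesis
        unfolding e potential_spacer(1)[OF y] potential_spacer(2)[OF y']
        by (simp add: power2_eq_square algebra_simps)
    qed
    show "(\<Sum>j\<le>N. incr \<Phi> (peak j - real N * \<delta>) (2 * real N * \<delta>))
      + (\<Sum>j<N. incr \<Phi> (trough j - (real N + 1) * \<delta>) (2 * (real N + 1) * \<delta>))
      + (\<Sum>j\<leftarrow>[0..<N]. incr \<Phi> (?a j) spacer + incr \<Phi> (?a j + (c + \<delta>)) spacer) = \<Phi> 1 - \<Phi> 0"
      for \<Phi> :: "real \<Rightarrow> real"
    proof -
      let ?f = "\<lambda>j. \<Phi> (peak j - real N * \<delta>)"
      have ends: "peak 0 - real N * \<delta> = 0" "peak N + real N * \<delta> = 1"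
        using l by (simp_all add: peak_def algebra_simps)
      have "(\<Sum>j\<le>N. incr \<Phi> (peak j - real N * \<delta>) (2 * real N * \<delta>))
        + (\<Sum>j<N. incr \<Phi> (trough j - (real N + 1) * \<delta>) (2 * (real N + 1) * \<delta>))
        + (\<Sum>j\<leftarrow>[0..<N]. incr \<Phi> (?a j) spacer + incr \<Phi> (?a j + (c + \<delta>)) spacer)
        = (\<Sum>j<N. ?f (Suc j) - ?f j) + (\<Phi> (peak N + real N * \<delta>) - ?f N)"
        unfolding partner incr_def cap_spacer_ends interv_sum_list_conv_sum_set_nat set_upt atLeast0LessThan
          lessThan_Suc_atMost[symmetric] sum.lessThan_Suc
        by (simp add: sum.distrib sum_subtractf)
      also have "\<dots> = \<Phi> (peak N + real N * \<delta>) - \<Phi> (peak 0 - real N * \<delta>)"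
        using sum_lessThan_telescope[of ?f N] by simp
      finally show ?thesis unfolding ends .
    qed
  qed blast
  show ?thesis
    by (rule that[OF M(1) _ _ M(4)]) (simp_all add: M(2,3) power2_eq_square algebra_simps)
qed

text \<open>Mean gaps above \<open>l = 1/(2N + 2)\<close>. The unit interval begins and ends with a spacer, and the spacer before the
\<open>j\<close>-th peak cap is translated onto the spacer after it.\<close>
lemma optimal_above:
  assumes l: "2 * (real N + 1) * (c - \<delta>) = 1"
  obtains M where "coupling M"
    "mean_gap M = c - \<delta> + 4 * real N * (real N + 1) * \<delta>\<^sup>2"
    "mean_sq_gap M = (c - \<delta>)\<^sup>2 + 2 * (c - \<delta>) * (4 * real N * (real N + 1) * \<delta>\<^sup>2)
       + 4 / 3 * (4 * real N * (real N + 1) * \<delta>\<^sup>2) * \<delta>"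
    "\<And>M'. coupling M' \<Longrightarrow> mean_gap M' = mean_gap M \<Longrightarrow> mean_sq_gap M \<le> mean_sq_gap M'"
proof -
  let ?a = "\<lambda>j. peak j - real N * \<delta> - spacer"
  have partner: "?a j + (c - \<delta>) = peak j + real N * \<delta>" for j
    by (simp add: spacer_def algebra_simps)
  have first: "?a j + spacer = peak j - real N * \<delta>" for j by simp
  have last: "trough j + (real N + 1) * \<delta> = ?a (Suc j)" for j
    using cap_spacer_ends(4)[of j] by simp
  have ends: "?a 0 = 0" "trough N - (real N + 1) * \<delta> = 1"
    using l by (simp_all add: peak_def trough_def spacer_def algebra_simps)
  obtain M where M: "coupling M"
    "mean_gap M = 4 * \<delta> * real N * (real N + 1) * c + (1 - 4 * \<delta> * real N * (real N + 1)) * (c - \<delta>)"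
    "mean_sq_gap M = 4 * \<delta> * real N * (real N + 1) * (c\<^sup>2 + \<delta>\<^sup>2 / 3)
       + (1 - 4 * \<delta> * real N * (real N + 1)) * (c - \<delta>)\<^sup>2"
    "\<And>M'. coupling M' \<Longrightarrow> mean_gap M' = mean_gap M \<Longrightarrow> mean_sq_gap M \<le> mean_sq_gap M'"
  proof (rule staircase_optimal[of "c - \<delta>" "[0..<Suc N]" ?a])
    have "(real N + 1) * \<delta> = real N * \<delta> + \<delta>" by (simp add: algebra_simps)
    then show "0 \<le> c - \<delta>" using cap_widths by linarith
    show "(c - \<delta> - c)\<^sup>2 = \<delta>\<^sup>2" by simp
    have "2 * spacer * real (Suc N) = 2 * (real N + 1) * (c - \<delta>) - 4 * \<delta> * real N * (real N + 1)"
      by (simp add: spacer_def algebra_simps)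
    then show "2 * spacer * real (length [0..<Suc N]) = 1 - 4 * \<delta> * real N * (real N + 1)"
      unfolding length_upt l by simp
    show "0 \<le> ?a j \<and> ?a j + (c - \<delta>) + spacer \<le> 1" if "j \<in> set [0..<Suc N]" for j
    proof -
      have "j \<le> N" using that by auto
      then have "2 * real j * c \<le> 2 * real N * c" "0 \<le> 2 * real j * c"
        using c by (auto intro: mult_right_mono)
      then have "peak 0 \<le> peak j" "peak j \<le> peak N" unfolding peak_def of_nat_0 by linarith+
      then show ?thesis
        using ends unfolding partner cap_spacer_ends trough_def by linarith
    qed
    show "potential (?a j + y) + potential (?a j + (c - \<delta>) + y) = \<delta>\<^sup>2"
      if "j \<in> set [0..<Suc N]" "0 \<le> y" "y \<le> spacer" for j y
    proof -
      have y: "real N * \<delta> \<le> real N * \<delta> + y" "real N * \<delta> + y \<le> c - (real N + 1) * \<delta>"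
        using that by (auto simp: spacer_def algebra_simps)
      have y': "real N * \<delta> \<le> c - (real N + 1) * \<delta> - y" "c - (real N + 1) * \<delta> - y \<le> c - (real N + 1) * \<delta>"
        using that by (auto simp: spacer_def algebra_simps)
      have e: "?a j + (c - \<delta>) + y = peak j + (real N * \<delta> + y)"
        "?a j + y = peak j - (c - (real N + 1) * \<delta> - y)"
        by (simp_all add: spacer_def algebra_simps)
      show ?thesis
        unfolding e potential_spacer(1)[OF y] potential_spacer(2)[OF y']
        by (simp add: power2_eq_square algebra_simps)
    qed
    show "(\<Sum>j\<le>N. incr \<Phi> (peak j - real N * \<delta>) (2 * real N * \<delta>))
      + (\<Sum>j<N. incr \<Phi> (trough j - (real N + 1) * \<delta>) (2 * (real N + 1) * \<delta>))
      + (\<Sum>j\<leftarrow>[0..<Suc N]. incr \<Phi> (?a j) spacer + incr \<Phi> (?a j + (c - \<delta>)) spacer) = \<Phi> 1 - \<Phi> 0"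
      for \<Phi> :: "real \<Rightarrow> real"
    proof -
      let ?f = "\<lambda>j. \<Phi> (?a j)"
      have "(\<Sum>j\<le>N. incr \<Phi> (peak j - real N * \<delta>) (2 * real N * \<delta>))
        + (\<Sum>j<N. incr \<Phi> (trough j - (real N + 1) * \<delta>) (2 * (real N + 1) * \<delta>))
        + (\<Sum>j\<leftarrow>[0..<Suc N]. incr \<Phi> (?a j) spacer + incr \<Phi> (?a j + (c - \<delta>)) spacer)
        = (\<Sum>j<N. ?f (Suc j) - ?f j) + (\<Phi> (trough N - (real N + 1) * \<delta>) - ?f N)"
        unfolding partner incr_def cap_spacer_ends first last interv_sum_list_conv_sum_set_nat set_upt
          atLeast0LessThan lessThan_Suc_atMost[symmetric] sum.lessThan_Suc
        by (simp add: sum.distrib sum_subtractf)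
      also have "\<dots> = \<Phi> (trough N - (real N + 1) * \<delta>) - \<Phi> (?a 0)"
        using sum_lessThan_telescope[of ?f N] by simp
      finally show ?thesis unfolding ends .
    qed
  qed blast
  show ?thesis
    by (rule that[OF M(1) _ _ M(4)]) (simp_all add: M(2,3) power2_eq_square algebra_simps)
qed

end

section \<open>The two boundaries of the region\<close>

lemma powr_three_halves: "0 \<le> x \<Longrightarrow> x powr (3/2) = x * sqrt x"
proof (cases "x = 0")
  case False
  assume "0 \<le> x"
  have "x powr (3/2) = x powr (1 + 1/2)" by simp
  also have "\<dots> = x powr 1 * x powr (1/2)" by (rule powr_add)
  finally have "x powr (3/2) = x powr 1 * x powr (1/2)" .
  with \<open>0 \<le> x\<close> False show ?thesis by (simp add: powr_half_sqrt)
qed simp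

text \<open>The displacement \<open>\<delta>\<close> is determined by \<open>\<bar>m - l\<bar> = 4N(N + 1)\<delta>\<^sup>2\<close>. The assumption \<open>near\<close> then reads \<open>4N(N + 1)\<delta> \<le> 1\<close>,
which is the condition that the caps fit.\<close>
lemma min_sq_gap:
  assumes N: "1 \<le> N" and side: "l = 1 / (2 * real N) \<and> m \<le> l \<or> l = 1 / (2 * real N + 2) \<and> l \<le> m"
    and near: "4 * real N * (real N + 1) * \<bar>m - l\<bar> \<le> 1"
  obtains M where "coupling M" "mean_gap M = m" "1 - 6 * mean_sq_gap M = rho_upper_at N m l"
    "\<And>M'. coupling M' \<Longrightarrow> mean_gap M' = m \<Longrightarrow> mean_sq_gap M \<le> mean_sq_gap M'"
proof -
  define \<Delta> where "\<Delta> = \<bar>m - l\<bar>"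
  define q where "q = 4 * real N * (real N + 1)"
  define \<delta> where "\<delta> = sqrt (\<Delta> / q)"
  have Np: "0 < real N" using N by simp
  have q: "0 < q" using Np by (simp add: q_def)
  have \<Delta>: "0 \<le> \<Delta>" by (simp add: \<Delta>_def)
  have \<delta>: "0 \<le> \<delta>" using \<Delta> q by (simp add: \<delta>_def)
  have q\<delta>: "q * \<delta>\<^sup>2 = \<Delta>" using \<Delta> q by (simp add: \<delta>_def)
  have "(q * \<delta>)\<^sup>2 \<le> 1\<^sup>2"
  proof -
    have "(q * \<delta>)\<^sup>2 = q * (q * \<delta>\<^sup>2)" by (simp add: power2_eq_square)
    also have "\<dots> \<le> 1" using near unfolding q\<delta> by (simp add: q_def \<Delta>_def)
    finally show ?thesis by simp
  qed
  then have small: "q * \<delta> \<le> 1" by (rule power2_le_imp_le) simp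
  have cost: "8 * \<Delta> * \<delta> = 4 * \<Delta> powr (3/2) / sqrt (real N * (real N + 1))"
  proof -
    have "sqrt q = 2 * sqrt (real N * (real N + 1))"
      by (simp add: q_def real_sqrt_mult)
    then have "\<delta> = sqrt \<Delta> / (2 * sqrt (real N * (real N + 1)))"
      by (simp add: \<delta>_def real_sqrt_divide)
    then show ?thesis using \<Delta> by (simp add: powr_three_halves)
  qed
  from side show ?thesis
  proof (elim disjE conjE)
    assume l: "l = 1 / (2 * real N)" and ml: "m \<le> l"
    have m: "m = l - \<Delta>" using ml by (simp add: \<Delta>_def)
    have l1: "2 * real N * l = 1" using Np by (simp add: l)
    have "(2 * real N + 2) * \<delta> * (2 * real N) \<le> l * (2 * real N)"
      using small l1 by (simp add: q_def algebra_simps)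
    then have fits: "(2 * real N + 2) * \<delta> \<le> l" using Np by simp
    have \<delta>N: "0 \<le> real N * \<delta>" using \<delta> by simp
    have lpos: "0 < l" using Np by (simp add: l)
    interpret staircase N "l - \<delta>" \<delta>
    proof
      show "(2 * real N + 1) * \<delta> \<le> l - \<delta>" using fits by (simp add: algebra_simps)
      have "(2 * real N + 2) * \<delta> = 2 * (real N * \<delta>) + 2 * \<delta>" by (simp add: algebra_simps)
      then show "0 < l - \<delta>" using fits \<delta>N \<delta> lpos by linarith
      show "real N * (l - \<delta> + \<delta>) \<le> 1/2" using l1 by simp
    qed (use N \<delta> in auto)
    obtain M where M: "coupling M"
      "mean_gap M = l - \<delta> + \<delta> - q * \<delta>\<^sup>2"
      "mean_sq_gap M = (l - \<delta> + \<delta>)\<^sup>2 - 2 * (l - \<delta> + \<delta>) * (q * \<delta>\<^sup>2) + 4 / 3 * (q * \<delta>\<^sup>2) * \<delta>"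
      "\<And>M'. coupling M' \<Longrightarrow> mean_gap M' = mean_gap M \<Longrightarrow> mean_sq_gap M \<le> mean_sq_gap M'"
      unfolding q_def by (rule optimal_below) (use l1 in auto)
    have mean: "mean_gap M = m" using M(2) by (simp add: q\<delta> m)
    have sq: "mean_sq_gap M = l\<^sup>2 - 2 * l * \<Delta> + 4 / 3 * \<Delta> * \<delta>" using M(3) by (simp add: q\<delta>)
    have "1 - 6 * mean_sq_gap M = 1 - 6 * l * (2 * m - l) - 8 * \<Delta> * \<delta>"
      unfolding sq m by (simp add: power2_eq_square algebra_simps)
    also have "\<dots> = rho_upper_at N m l"
      by (simp only: rho_upper_at_def \<Delta>_def[symmetric] cost)
    finally have "1 - 6 * mean_sq_gap M = rho_upper_at N m l" .
    then show ?thesis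
      by (rule that[OF M(1) mean]) (use M(4) mean in simp)
  next
    assume l: "l = 1 / (2 * real N + 2)" and ml: "l \<le> m"
    have m: "m = l + \<Delta>" using ml by (simp add: \<Delta>_def)
    have l1: "2 * (real N + 1) * l = 1" using Np by (simp add: l)
    have "2 * real N * \<delta> * (2 * (real N + 1)) \<le> l * (2 * (real N + 1))"
      using small l1 by (simp add: q_def algebra_simps)
    then have fits: "2 * real N * \<delta> \<le> l" by (rule mult_right_le_imp_le) simp
    have lpos: "0 < l" using Np by (simp add: l)
    interpret staircase N "l + \<delta>" \<delta>
    proof
      show "(2 * real N + 1) * \<delta> \<le> l + \<delta>" using fits by (simp add: algebra_simps)
      show "real N * (l + \<delta> + \<delta>) \<le> 1/2" using fits l1 by (simp add: algebra_simps)
    qed (use N \<delta> lpos in auto)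
    obtain M where M: "coupling M"
      "mean_gap M = l + \<delta> - \<delta> + q * \<delta>\<^sup>2"
      "mean_sq_gap M = (l + \<delta> - \<delta>)\<^sup>2 + 2 * (l + \<delta> - \<delta>) * (q * \<delta>\<^sup>2) + 4 / 3 * (q * \<delta>\<^sup>2) * \<delta>"
      "\<And>M'. coupling M' \<Longrightarrow> mean_gap M' = mean_gap M \<Longrightarrow> mean_sq_gap M \<le> mean_sq_gap M'"
      unfolding q_def by (rule optimal_above) (use l1 in auto)
    have mean: "mean_gap M = m" using M(2) by (simp add: q\<delta> m)
    have sq: "mean_sq_gap M = l\<^sup>2 + 2 * l * \<Delta> + 4 / 3 * \<Delta> * \<delta>" using M(3) by (simp add: q\<delta>)
    have "1 - 6 * mean_sq_gap M = 1 - 6 * l * (2 * m - l) - 8 * \<Delta> * \<delta>"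
      unfolding sq m by (simp add: power2_eq_square algebra_simps)
    also have "\<dots> = rho_upper_at N m l"
      by (simp only: rho_upper_at_def \<Delta>_def[symmetric] cost)
    finally have "1 - 6 * mean_sq_gap M = rho_upper_at N m l" .
    then show ?thesis
      by (rule that[OF M(1) mean]) (use M(4) mean in simp)
  qed
qed

text \<open>The inner half-width \<open>a\<close> solves \<open>1/2 - 2a\<^sup>2 = (1 - x)/3\<close>.\<close>
lemma lower_attained:
  assumes x: "x \<in> {-1/2..1}"
  obtains M where "coupling M" "mean_gap M = (1 - x) / 3" "1 - 6 * mean_sq_gap M = rho_lower x"
    "\<And>M'. coupling M' \<Longrightarrow> mean_gap M' = (1 - x) / 3 \<Longrightarrow> mean_sq_gap M' \<le> mean_sq_gap M"
proof -
  define a where "a = sqrt ((1 + 2 * x) / 12)"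
  have nonneg: "0 \<le> (1 + 2 * x) / 12" using x by auto
  have a2: "a\<^sup>2 = (1 + 2 * x) / 12" using nonneg by (simp add: a_def)
  have a: "0 \<le> a" "a \<le> 1/2"
  proof -
    show "0 \<le> a" using nonneg by (simp add: a_def)
    have "a\<^sup>2 \<le> (1/2)\<^sup>2" unfolding a2 using x by (auto simp: power2_eq_square)
    then show "a \<le> 1/2" by (rule power2_le_imp_le) simp
  qed
  obtain M where M: "coupling M" "mean_gap M = 1/2 - 2 * a\<^sup>2" "mean_sq_gap M = 1/3 - 8/3 * a ^ 3"
    "\<And>M'. coupling M' \<Longrightarrow> mean_gap M' = mean_gap M \<Longrightarrow> mean_sq_gap M' \<le> mean_sq_gap M"
    using max_sq_gap[OF a] by blast
  have mean: "mean_gap M = (1 - x) / 3" unfolding M(2) a2 by (simp add: field_simps)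
  have "(1 + 2 * x) powr (3/2) = 12 * a\<^sup>2 * sqrt (12 * a\<^sup>2)"
  proof -
    have "12 * a\<^sup>2 = 1 + 2 * x" by (simp add: a2)
    then show ?thesis using nonneg by (simp add: powr_three_halves)
  qed
  also have "\<dots> = 24 * sqrt 3 * a ^ 3"
  proof -
    have "sqrt 12 = sqrt (2\<^sup>2 * 3)" by simp
    also have "\<dots> = 2 * sqrt 3" by (simp only: real_sqrt_mult real_sqrt_power) simp
    finally show ?thesis using a(1) by (simp add: real_sqrt_mult power2_eq_square power3_eq_cube)
  qed
  finally have "rho_lower x = 2 * (sqrt 3 * sqrt 3) / 9 * (24 * a ^ 3) - 1"
    unfolding rho_lower_def by simp
  then have "1 - 6 * mean_sq_gap M = rho_lower x" unfolding M(3) by simp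
  then show ?thesis
    by (rule that[OF M(1) mean]) (use M(4) mean in simp)
qed

text \<open>Halfway between the endpoints the distance to either is \<open>1/(4N(N + 1))\<close>, so the nearest endpoint always
satisfies the closeness condition of \<open>min_sq_gap\<close>. For \<open>x = 1\<close> the coupling is \<open>V = U\<close>.\<close>
lemma upper_attained:
  assumes x: "x \<in> {-1/2..1}"
  obtains M where "coupling M" "mean_gap M = (1 - x) / 3" "1 - 6 * mean_sq_gap M = rho_upper x"
    "\<And>M'. coupling M' \<Longrightarrow> mean_gap M' = (1 - x) / 3 \<Longrightarrow> mean_sq_gap M \<le> mean_sq_gap M'"
proof (cases "x = 1")
  case True
  obtain M where M: "coupling M" "mean_gap M = 1/2 - 2 * (1/2)\<^sup>2" "mean_sq_gap M = 1/3 - 8/3 * (1/2) ^ 3"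
    using max_sq_gap[of "1/2"] by auto
  have "mean_sq_gap M = 0" using M(3) by (simp add: power3_eq_cube)
  then show ?thesis
    using that[OF M(1)] M(2) True mean_gap_bounds(3) by (simp add: rho_upper_def power2_eq_square)
next
  case False
  with x have x': "-1/2 \<le> x" "x < 1" by auto
  obtain N where seg: "in_segment x N" using segment_ex1[OF x'] by blast
  define m where "m = (1 - x) / 3"
  have N: "1 \<le> N" using seg by (simp add: in_segment_def)
  then have Np: "0 < real N" by simp
  define h where "h = 1 / (2 * real N)"
  define h' where "h' = 1 / (2 * real N + 2)"
  have m: "h' \<le> m" "m \<le> h"
    using seg by (auto simp: in_segment_def m_def h_def h'_def field_simps)
  have width: "h - h' = 1 / (2 * real N * (real N + 1))"
    using Np by (simp add: h_def h'_def divide_simps)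
  have near: "4 * real N * (real N + 1) * d \<le> 1" if "2 * d \<le> h - h'" for d
  proof -
    have "2 * real N * (real N + 1) * (2 * d) \<le> 2 * real N * (real N + 1) * (h - h')"
      using that Np by (intro mult_left_mono) auto
    then show ?thesis unfolding width using Np by (simp add: mult.assoc)
  qed
  obtain l where l: "l = h \<and> m \<le> l \<or> l = h' \<and> l \<le> m" "2 * \<bar>m - l\<bar> \<le> h - h'"
    and arg: "is_arg_min (\<lambda>l. \<bar>m - l\<bar>) (\<lambda>l. l \<in> segment_ends N) l"
  proof (cases "h - m \<le> m - h'")
    case True
    show ?thesis
      by (rule that[of h]) (use m True in \<open>auto simp: is_arg_min_linorder segment_ends_def h_def[symmetric] h'_def[symmetric]\<close>)
  next
    case False
    show ?thesis
      by (rule that[of h']) (use m False in \<open>auto simp: is_arg_min_linorder segment_ends_def h_def[symmetric] h'_def[symmetric]\<close>)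
  qed
  obtain M where M: "coupling M" "mean_gap M = m" "1 - 6 * mean_sq_gap M = rho_upper_at N m l"
    "\<And>M'. coupling M' \<Longrightarrow> mean_gap M' = m \<Longrightarrow> mean_sq_gap M \<le> mean_sq_gap M'"
    using min_sq_gap[OF N l(1)[unfolded h_def h'_def] near[OF l(2)]] by blast
  have "rho_upper x = rho_upper_at N m l"
    by (rule rho_upper_eq[OF x' seg m_def arg])
  then show ?thesis using that[of M] M unfolding m_def by simp
qed

theorem corollary1p2:
  shows "{(spearman_rho C, spearman_footrule C) |C. copula C} =
         {(r, x) |r x. x \<in> {-1/2..1} \<and> rho_lower x \<le> r \<and> r \<le> rho_upper x}"
  unfolding range_eq_gap_moments
proof (intro set_eqI iffI; clarify)
  fix M assume M: "coupling M"
  let ?x = "1 - 3 * mean_gap M"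
  have x: "?x \<in> {-1/2..1}" using mean_gap_bounds[OF M] by auto
  have m: "mean_gap M = (1 - ?x) / 3" by simp
  obtain M1 where M1: "1 - 6 * mean_sq_gap M1 = rho_lower ?x" "mean_sq_gap M \<le> mean_sq_gap M1"
    using lower_attained[OF x] M m by metis
  obtain M2 where M2: "1 - 6 * mean_sq_gap M2 = rho_upper ?x" "mean_sq_gap M2 \<le> mean_sq_gap M"
    using upper_attained[OF x] M m by metis
  have "rho_lower ?x \<le> 1 - 6 * mean_sq_gap M" "1 - 6 * mean_sq_gap M \<le> rho_upper ?x"
    using M1 M2 by linarith+
  with x show "\<exists>r x. (1 - 6 * mean_sq_gap M, ?x) = (r, x) \<and> x \<in> {-1/2..1} \<and> rho_lower x \<le> r \<and> r \<le> rho_upper x"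
    by blast
next
  fix r x assume x: "x \<in> {-1/2..1}" and r: "rho_lower x \<le> r" "r \<le> rho_upper x"
  obtain M1 where M1: "coupling M1" "mean_gap M1 = (1 - x) / 3" "1 - 6 * mean_sq_gap M1 = rho_lower x"
    using lower_attained[OF x] by metis
  obtain M2 where M2: "coupling M2" "mean_gap M2 = (1 - x) / 3" "1 - 6 * mean_sq_gap M2 = rho_upper x"
    using upper_attained[OF x] by metis
  have "r \<in> closed_segment (rho_upper x) (rho_lower x)"
    using r by (simp add: closed_segment_eq_real_ivl)
  then obtain \<theta> where \<theta>: "0 \<le> \<theta>" "\<theta> \<le> 1" "r = (1 - \<theta>) * rho_upper x + \<theta> * rho_lower x"
    by (auto simp: closed_segment_def)
  obtain M where M: "coupling M" "mean_gap M = \<theta> * mean_gap M1 + (1 - \<theta>) * mean_gap M2"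
    "mean_sq_gap M = \<theta> * mean_sq_gap M1 + (1 - \<theta>) * mean_sq_gap M2"
    using coupling_convex[OF M1(1) M2(1) \<theta>(1,2)] by blast
  have "1 - 6 * mean_sq_gap M = r"
    unfolding M(3) \<theta>(3) M1(3)[symmetric] M2(3)[symmetric] by (simp add: algebra_simps)
  moreover have "mean_gap M = (1 - x) / 3"
    unfolding M(2) M1(2) M2(2) by (simp only: distrib_right[symmetric]) simp
  ultimately show "\<exists>M. (r, x) = (1 - 6 * mean_sq_gap M, 1 - 3 * mean_gap M) \<and> coupling M"
    using M(1) by (intro exI[of _ M]) simp
qed

end
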